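(* Let $d\ge2$, let $D\in\mathbb{C}[t]$ be squarefree of degree $2d$, let $(A,B)$ be a solution of degree $n$ of the Pell–Abel equation $A^2-DB^2=1$, and let $G_A\le S_{2n}$ be the monodromy group of $\phi_A=A^2$. Then for every positive integer $m$ with $m\mid n$ and $n/m\ge d$, the solution $(A,B)$ is the $m$-th power of another solution of the same Pell–Abel equation if and only if $G_A$ is $2m$-imprimitive.
   Context: Pell–Abel equation: for $D\in\mathbb{C}[t]$, solutions are pairs $(A,B)\in\mathbb{C}[t]^2$ with $A^2-DB^2=1$ and $B\neq0$; the degree of a solution is $\deg A$. A solution $(A,B)$ is the $m$-th power of a solution $(A',B')$ if $A+\sqrt{D}B=\pm(A'\pm\sqrt{D}B')^m$ for some choice of signs. Monodromy group: for the polynomial map $\phi_A=A^2:\mathbb{P}^1(\mathbb{C})\to\mathbb{P}^1(\mathbb{C})$ of degree $2n$, choose a non-branch base point $q$, label $\phi_A^{-1}(q)$ by $\{1,\dots,2n\}$; lifting loops based at $q$ gives a homomorphism $\pi_1(\mathbb{P}^1\setminus\{\text{branch points}\},q)\to S_{2n}$, whose image $G_A$ (a transitive subgroup, well defined up to conjugation in $S_{2n}$) is the monodromy group. For $\ell\mid 2n$, an $\ell$-partition of $\{1,\dots,2n\}$ is a partition into $\ell$ subsets each of cardinality $2n/\ell$; a subgroup $G\le S_{2n}$ is $\ell$-imprimitive if some $\ell$-partition is preserved by $G$ (every element of $G$ maps each block onto a block). *)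

theory Defs
  imports "HOL-Analysis.Analysis" "HOL-Computational_Algebra.Polynomial"
    "HOL-Computational_Algebra.Squarefree" "HOL-Library.Disjoint_Sets"
begin

definition pell_solution :: "complex poly \<Rightarrow> complex poly \<Rightarrow> complex poly \<Rightarrow> bool" where
  "pell_solution D A B \<longleftrightarrow> A^2 - D * B^2 = 1 \<and> B \<noteq> 0"

text \<open>Multiplication in C[t][sqrt D]: (a + sqrt D b)(c + sqrt D e).\<close>
definition pell_mult :: "complex poly \<Rightarrow> complex poly \<times> complex poly \<Rightarrow> complex poly \<times> complex poly
    \<Rightarrow> complex poly \<times> complex poly" where
  "pell_mult D x y = (fst x * fst y + D * snd x * snd y, fst x * snd y + snd x * fst y)"

primrec pell_pow :: "complex poly \<Rightarrow> complex poly \<times> complex poly \<Rightarrow> nat \<Rightarrow> complex poly \<times> complex poly" where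
  "pell_pow D x 0 = (1, 0)"
| "pell_pow D x (Suc k) = pell_mult D x (pell_pow D x k)"

definition is_pell_power :: "complex poly \<Rightarrow> complex poly \<Rightarrow> complex poly \<Rightarrow> nat
    \<Rightarrow> complex poly \<Rightarrow> complex poly \<Rightarrow> bool" where
  "is_pell_power D A B m A' B' \<longleftrightarrow>
     (\<exists>s1 s2. s1 \<in> {1, -1} \<and> s2 \<in> {1, -1} \<and>
        (A, B) = (\<lambda>(a, b). (smult s1 a, smult s1 b)) (pell_pow D (A', smult s2 B') m))"

definition crit_values :: "complex poly \<Rightarrow> complex set" where
  "crit_values P = {poly P w | w. poly (pderiv P) w = 0}"

definition fiber :: "complex poly \<Rightarrow> complex \<Rightarrow> complex set" where
  "fiber P q = {z. poly P z = q}"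

text \<open>Monodromy group of z |-> P(z) at base point q, as permutations of the fibre over q
  (extended by the identity outside the fibre): the permutation induced by lifting each loop
  at q avoiding the branch points (loops in P^1 minus branch points = loops in C minus finite ones).\<close>
definition monodromy_group :: "complex poly \<Rightarrow> complex \<Rightarrow> (complex \<Rightarrow> complex) set" where
  "monodromy_group P q = {\<sigma>. \<exists>\<gamma>. path \<gamma> \<and> pathstart \<gamma> = q \<and> pathfinish \<gamma> = q \<and>
       path_image \<gamma> \<inter> crit_values P = {} \<and>
       (\<forall>z \<in> fiber P q. \<exists>p. path p \<and> pathstart p = z \<and>
            (\<forall>t\<in>{0..1}. poly P (p t) = \<gamma> t) \<and> pathfinish p = \<sigma> z) \<and>
       (\<forall>z. z \<notin> fiber P q \<longrightarrow> \<sigma> z = z)}"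

definition imprimitive :: "nat \<Rightarrow> ('a \<Rightarrow> 'a) set \<Rightarrow> 'a set \<Rightarrow> bool" where
  "imprimitive l G F \<longleftrightarrow> (\<exists>Q. partition_on F Q \<and> card Q = l \<and>
      (\<forall>b\<in>Q. card b = card F div l) \<and> (\<forall>\<sigma>\<in>G. \<forall>b\<in>Q. \<sigma> ` b \<in> Q))"

end

theory Submission
  imports Defs "HOL-Complex_Analysis.Complex_Analysis"
    "HOL-Computational_Algebra.Fundamental_Theorem_Algebra"
begin

text \<open>
  An \<open>m\<close>-th power \<open>(A, B)\<close> of \<open>(A', B')\<close> has \<open>A = \<plusminus> T\<^sub>m(A')\<close> with \<open>T\<^sub>m\<close> the Chebyshev polynomial, so
  \<open>A\<^sup>2 = T\<^sub>m\<^sup>2 \<circ> A'\<close> and the fibres of \<open>A'\<close> are blocks of the monodromy group. Conversely, blocks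
  transported along paths give a decomposition \<open>A\<^sup>2 = R \<circ> g\<close> with \<open>degree g = n / m\<close>. Counting the
  roots of odd multiplicity by Riemann--Hurwitz shows that \<open>R = S\<^sup>2\<close> and, because \<open>n / m \<ge> d\<close>, that
  \<open>S\<^sup>2 - 1\<close> has exactly two roots of odd multiplicity; an affine change of variable moves them to
  \<open>1\<close> and \<open>-1\<close>. Then \<open>S\<close> solves the Pell--Abel equation for \<open>y\<^sup>2 - 1\<close>, hence \<open>S = \<plusminus> T\<^sub>m\<close>, and
  \<open>g\<^sup>2 - 1 = D C\<^sup>2\<close> for some \<open>C\<close>, so \<open>(g, C)\<close> is the solution sought.
\<close>

subsection \<open>Roots of odd multiplicity\<close>

text \<open>For \<open>p \<noteq> 0\<close> these are the finite branch points of the curve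
  \<open>y^2 = p(x)\<close>; they depend on \<open>p\<close> only up to nonzero square
  factors.\<close>

definition odd_roots :: "complex poly \<Rightarrow> complex set" where
  "odd_roots p = {w. odd (order w p)}"

lemma odd_roots_subset: "p \<noteq> 0 \<Longrightarrow> odd_roots p \<subseteq> {w. poly p w = 0}"
  by (auto simp: odd_roots_def order_root intro: Nat.gr0I)

lemma finite_odd_roots: "p \<noteq> 0 \<Longrightarrow> finite (odd_roots p)"
  by (rule finite_subset[OF odd_roots_subset poly_roots_finite])

lemma sum_order_eq_degree:
  fixes p :: "complex poly"
  assumes "p \<noteq> 0"
  shows "(\<Sum>w | poly p w = 0. order w p) = degree p"
proof -
  have "degree p = degree (smult (lead_coeff p) (\<Prod>z|poly p z = 0. [:-z, 1:] ^ order z p))"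
    by (simp add: complex_poly_decompose)
  also have "\<dots> = degree (\<Prod>z|poly p z = 0. [:-z, 1:] ^ order z p)"
    using assms by simp
  also have "\<dots> = (\<Sum>w | poly p w = 0. order w p)"
    by (subst degree_prod_eq_sum_degree) (auto simp: degree_power_eq)
  finally show ?thesis by simp
qed

lemma even_card_odd_roots:
  assumes "p \<noteq> 0"
  shows "even (card (odd_roots p)) \<longleftrightarrow> even (degree p)"
proof -
  have fin: "finite {w. poly p w = 0}" by (rule poly_roots_finite[OF assms])
  have "{w \<in> {w. poly p w = 0}. odd (order w p)} = odd_roots p"
    using odd_roots_subset[OF assms] by (auto simp: odd_roots_def)
  then show ?thesis
    using even_sum_iff[OF fin, of "\<lambda>w. order w p"] sum_order_eq_degree[OF assms] by simp
qed

text \<open>Halve all exponents in the factorisation into linear factors; the leading coefficient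
  has a complex square root.\<close>

lemma odd_roots_empty_imp_square:
  assumes "odd_roots p = {}"
  obtains s :: "complex poly" where "p = s\<^sup>2"
proof -
  define s where "s = smult (csqrt (lead_coeff p)) (\<Prod>z|poly p z = 0. [:-z, 1:] ^ (order z p div 2))"
  have ev: "even (order z p)" for z
    using assms by (auto simp: odd_roots_def)
  have "s\<^sup>2 = smult (lead_coeff p) (\<Prod>z|poly p z = 0. ([:-z, 1:] ^ (order z p div 2))\<^sup>2)"
    unfolding s_def smult_power prod_power_distrib[symmetric] by simp
  also have "\<dots> = smult (lead_coeff p) (\<Prod>z|poly p z = 0. [:-z, 1:] ^ order z p)"
    by (intro arg_cong[where f = "smult _"] prod.cong refl)
       (metis ev dvd_div_mult_self power_mult)
  also have "\<dots> = p" by (rule complex_poly_decompose)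
  finally show ?thesis using that by blast
qed

lemma odd_roots_square: "s \<noteq> 0 \<Longrightarrow> odd_roots (s\<^sup>2) = {}"
  by (auto simp: odd_roots_def power2_eq_square order_mult)

lemma odd_roots_mult_square:
  assumes "p \<noteq> 0" "s \<noteq> 0"
  shows "odd_roots (p * s\<^sup>2) = odd_roots p"
  using assms by (auto simp: odd_roots_def power2_eq_square order_mult)

lemma odd_roots_rsquarefree:
  assumes "rsquarefree p"
  shows "odd_roots p = {w. poly p w = 0}"
  using assms odd_roots_subset[of p] rsquarefree_root_order[OF assms]
  by (auto simp: odd_roots_def rsquarefree_def)

lemma card_roots_rsquarefree:
  fixes p :: "complex poly"
  assumes "rsquarefree p"
  shows "card {w. poly p w = 0} = degree p"
proof -
  have "p \<noteq> 0" using assms by (simp add: rsquarefree_def)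
  have "(\<Sum>w | poly p w = 0. order w p) = (\<Sum>w | poly p w = 0. 1)"
    by (rule sum.cong) (use rsquarefree_root_order[OF assms] \<open>p \<noteq> 0\<close> in auto)
  then show ?thesis using sum_order_eq_degree[OF \<open>p \<noteq> 0\<close>] by simp
qed

lemma squarefree_imp_rsquarefree:
  fixes p :: "complex poly"
  assumes "squarefree p"
  shows "rsquarefree p"
proof -
  have p0: "p \<noteq> 0" using assms by auto
  have "order a p \<le> 1" for a
  proof (rule ccontr)
    assume "\<not> order a p \<le> 1"
    then have "[:-a, 1:] ^ 2 dvd p" by (subst order_divides) auto
    then have "[:-a, 1:] dvd 1" using assms squarefreeD by blast
    then show False by (simp add: is_unit_iff_degree)
  qed
  then show ?thesis using p0 unfolding rsquarefree_def
    by (metis One_nat_def le_Suc_eq le_zero_eq)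
qed

lemma prod_linear_factors_dvd:
  fixes p :: "'a::idom poly"
  assumes "finite Z" "\<And>z. z \<in> Z \<Longrightarrow> poly p z = 0"
  shows "(\<Prod>z\<in>Z. [:-z, 1:]) dvd p"
  using assms
proof (induction Z)
  case (insert z Z)
  then obtain u where u: "p = (\<Prod>z\<in>Z. [:-z, 1:]) * u" by (auto elim: dvdE)
  have "poly (\<Prod>z\<in>Z. [:-z, 1:]) z \<noteq> 0" using insert.hyps by (auto simp: poly_prod)
  moreover have "poly p z = 0" using insert.prems by simp
  ultimately have "poly u z = 0" by (simp add: u)
  then have "[:-z, 1:] dvd u" by (simp add: poly_eq_0_iff_dvd)
  then show ?case using insert.hyps by (simp add: u mult.commute[of "[:-z, 1:]"] mult_dvd_mono del: mult_pCons_left mult_pCons_right)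
qed simp

text \<open>The root count makes \<open>p\<close> a constant multiple of a product of distinct
  linear factors. Serves both for \<open>D\<close> dividing \<open>h^2 - 1\<close> and for
  \<open>g - g(z)\<close> dividing \<open>p - p(z)\<close>.\<close>

lemma dvd_if_distinct_roots:
  fixes p f :: "'a::field poly"
  assumes "p \<noteq> 0" "card {w. poly p w = 0} = degree p"
    and "\<And>w. poly p w = 0 \<Longrightarrow> poly f w = 0"
  shows "p dvd f"
proof -
  let ?L = "\<Prod>z | poly p z = 0. [:-z, 1:]"
  have fin: "finite {w. poly p w = 0}" by (rule poly_roots_finite[OF assms(1)])
  obtain c where c: "p = ?L * c"
    using prod_linear_factors_dvd[OF fin, of p] by (auto elim: dvdE)
  have "degree ?L = degree p"
    by (subst degree_prod_eq_sum_degree) (auto simp: assms(2))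
  moreover have "degree p = degree ?L + degree c"
    using assms(1) c by (metis degree_mult_eq mult_eq_0_iff)
  ultimately have "degree c = 0" by simp
  moreover have "c \<noteq> 0" using assms(1) c by auto
  ultimately have "p dvd ?L"
    by (subst c) (auto elim!: degree_eq_zeroE simp: is_unit_iff_degree mult_unit_dvd_iff)
  moreover have "?L dvd f" using prod_linear_factors_dvd[OF fin] assms(3) by simp
  ultimately show ?thesis by (rule dvd_trans)
qed

lemma degree_diff_const:
  fixes p :: "'a::ab_group_add poly"
  shows "degree (p - [:y:]) = degree p"
proof (cases "degree p = 0")
  case True
  then show ?thesis by (auto elim!: degree_eq_zeroE)
next
  case False
  then show ?thesis
    using degree_add_eq_left[of "-[:y:]" p] by (simp only: diff_conv_add_uminus degree_minus degree_pCons_0)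
qed

lemma diff_const_nonzero: "degree p > 0 \<Longrightarrow> p - [:y:] \<noteq> 0" for p :: "'a::ab_group_add poly"
  using degree_diff_const[of p y] by auto

text \<open>Riemann--Hurwitz for the polynomial map \<open>g\<close>: a root of \<open>g - y\<close> of order \<open>e\<close> is a zero of
  \<open>pderiv g\<close> of order \<open>e - 1\<close>, and \<open>e \<le> 2 (e - 1)\<close> unless \<open>e\<close> is odd.\<close>
lemma card_odd_roots_ge:
  fixes g :: "complex poly"
  assumes g: "degree g > 0" and Y: "finite Y"
  shows "card Y * degree g + 2 \<le> (\<Sum>y\<in>Y. card (odd_roots (g - [:y:]))) + 2 * degree g"
proof -
  let ?Z = "\<lambda>y. {w. poly g w = y}"
  have deg: "degree (g - [:y:]) = degree g" for y by (rule degree_diff_const)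
  have nz: "g - [:y:] \<noteq> 0" for y by (rule diff_const_nonzero[OF g])
  have Zr: "?Z y = {w. poly (g - [:y:]) w = 0}" for y by auto
  have finZ: "finite (?Z y)" for y unfolding Zr by (rule poly_roots_finite[OF nz])
  have ord: "order w (g - [:y:]) = Suc (order w (pderiv g))" if "w \<in> ?Z y" for w y
    using order_pderiv[OF nz, of y w] that by (simp add: pderiv_diff pderiv_pCons)
  have g': "pderiv g \<noteq> 0" using g by (simp add: pderiv_eq_0_iff)
  have each: "degree g \<le> card (odd_roots (g - [:y:])) + 2 * (\<Sum>w\<in>?Z y. order w (pderiv g))" for y
  proof -
    have "degree g = (\<Sum>w\<in>?Z y. order w (g - [:y:]))"
      by (simp only: Zr sum_order_eq_degree[OF nz] deg)
    also have "\<dots> \<le> (\<Sum>w\<in>?Z y. (if odd (order w (g - [:y:])) then 1 else 0) + 2 * order w (pderiv g))"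
      by (rule sum_mono) (use ord in auto)
    also have "\<dots> = card {w\<in>?Z y. odd (order w (g - [:y:]))} + 2 * (\<Sum>w\<in>?Z y. order w (pderiv g))"
      using finZ by (simp add: sum.distrib sum_distrib_left sum.If_cases Int_def)
    also have "{w\<in>?Z y. odd (order w (g - [:y:]))} = odd_roots (g - [:y:])"
      using odd_roots_subset[OF nz, of y] by (auto simp: odd_roots_def)
    finally show ?thesis .
  qed
  \<comment> \<open>Fibres over distinct \<open>y\<close> are disjoint, so each zero of
    \<open>pderiv g\<close> is counted at most once.\<close>
  have "(\<Sum>y\<in>Y. \<Sum>w\<in>?Z y. order w (pderiv g)) = (\<Sum>w\<in>(\<Union>y\<in>Y. ?Z y). order w (pderiv g))"
    by (rule sum.UNION_disjoint[symmetric]) (use Y finZ in auto)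
  also have "\<dots> = (\<Sum>w\<in>(\<Union>y\<in>Y. ?Z y) \<inter> {w. poly (pderiv g) w = 0}. order w (pderiv g))"
    by (rule sum.mono_neutral_right) (use Y finZ order_root[of "pderiv g"] in auto)
  also have "\<dots> \<le> (\<Sum>w | poly (pderiv g) w = 0. order w (pderiv g))"
    by (rule sum_mono2) (use poly_roots_finite[OF g'] in auto)
  also have "\<dots> = degree g - 1"
    using sum_order_eq_degree[OF g'] by (simp add: degree_pderiv)
  finally have tot: "(\<Sum>y\<in>Y. \<Sum>w\<in>?Z y. order w (pderiv g)) \<le> degree g - 1" .
  have "card Y * degree g = (\<Sum>y\<in>Y. degree g)" by simp
  also have "\<dots> \<le> (\<Sum>y\<in>Y. card (odd_roots (g - [:y:])) + 2 * (\<Sum>w\<in>?Z y. order w (pderiv g)))"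
    by (rule sum_mono) (rule each)
  also have "\<dots> = (\<Sum>y\<in>Y. card (odd_roots (g - [:y:]))) + 2 * (\<Sum>y\<in>Y. \<Sum>w\<in>?Z y. order w (pderiv g))"
    by (simp add: sum.distrib sum_distrib_left)
  finally show ?thesis using tot g by linarith
qed

section \<open>Roots of odd order under composition\<close>

lemma pcompose_power: "(p ^ k) \<circ>\<^sub>p g = (p \<circ>\<^sub>p g) ^ k" for p g :: "'a::comm_semiring_1 poly"
  by (induction k) (auto simp: pcompose_mult pcompose_1)

lemma pcompose_linear: "[:-y, 1:] \<circ>\<^sub>p g = g - [:y:]" for g :: "'a::comm_ring_1 poly"
  by (simp add: poly_eq_iff pcompose_pCons coeff_pCons split: nat.split)

text \<open>Split \<open>R = (x - y)^k * R0\<close> with \<open>R0(y) \<noteq> 0\<close>, where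
  \<open>y = g(w)\<close>; after substituting \<open>g\<close>, only the first factor can vanish at
  \<open>w\<close>.\<close>

lemma order_pcompose:
  fixes R g :: "complex poly"
  assumes R: "R \<noteq> 0" and g: "degree g > 0"
  shows "order w (R \<circ>\<^sub>p g) = order (poly g w) R * order w (g - [:poly g w:])"
proof -
  define y where "y = poly g w"
  define k where "k = order y R"
  obtain R0 where R0: "R = [:-y, 1:] ^ k * R0" "\<not> [:-y, 1:] dvd R0"
    using order_decomp[OF R] unfolding k_def by blast
  have y0: "poly R0 y \<noteq> 0" using R0(2) by (simp add: poly_eq_0_iff_dvd)
  have "R \<circ>\<^sub>p g = (g - [:y:]) ^ k * (R0 \<circ>\<^sub>p g)"
    by (simp add: R0(1) pcompose_mult pcompose_power pcompose_linear)
  moreover have "R \<circ>\<^sub>p g \<noteq> 0" using R g by (metis pcompose_eq_0)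
  ultimately have "order w (R \<circ>\<^sub>p g) = order w ((g - [:y:]) ^ k) + order w (R0 \<circ>\<^sub>p g)"
    by (simp add: order_mult)
  moreover have "order w (R0 \<circ>\<^sub>p g) = 0"
    by (rule order_0I) (simp add: poly_pcompose y0 flip: y_def)
  moreover have "g - [:y:] \<noteq> 0" using g by auto
  then have "order w ((g - [:y:]) ^ k) = k * order w (g - [:y:])"
    by (induction k) (simp_all add: order_mult)
  ultimately show ?thesis by (simp add: k_def y_def)
qed

text \<open>By \<open>order_pcompose\<close> the order at \<open>w\<close> is a product, and a
  product is odd only if both factors are.\<close>

lemma odd_roots_pcompose:
  assumes "R \<noteq> 0" "degree g > 0"
  shows "odd_roots (R \<circ>\<^sub>p g) = (\<Union>y\<in>odd_roots R. odd_roots (g - [:y:]))"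
proof -
  have *: "poly g w = y" if "w \<in> odd_roots (g - [:y:])" for w y
  proof -
    have "g - [:y:] \<noteq> 0" using assms(2) by auto
    then have "w \<in> {w. poly (g - [:y:]) w = 0}"
      using odd_roots_subset[of "g - [:y:]"] that by (auto simp: odd_roots_def)
    then show ?thesis by simp
  qed
  have "w \<in> odd_roots (R \<circ>\<^sub>p g) \<longleftrightarrow>
      poly g w \<in> odd_roots R \<and> w \<in> odd_roots (g - [:poly g w:])" for w
    by (simp add: odd_roots_def order_pcompose[OF assms])
  then show ?thesis using * by blast
qed

lemma card_odd_roots_pcompose:
  assumes "R \<noteq> 0" "degree g > 0"
  shows "card (odd_roots (R \<circ>\<^sub>p g)) = (\<Sum>y\<in>odd_roots R. card (odd_roots (g - [:y:])))"
proof -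
  have nz: "g - [:y:] \<noteq> 0" for y using assms(2) by auto
  have "odd_roots (g - [:y:]) \<subseteq> {w. poly g w = y}" for y
    using odd_roots_subset[OF nz, of y] by auto
  then show ?thesis unfolding odd_roots_pcompose[OF assms]
    by (intro card_UN_disjoint) (use finite_odd_roots nz assms in \<open>blast+\<close>)
qed

subsection \<open>The Pell--Abel equation for \<open>y\<^sup>2 - 1\<close>\<close>

text \<open>The pair \<open>(T\<^sub>k, U\<^sub>k\<^sub>-\<^sub>1)\<close> of Chebyshev polynomials.\<close>
definition cheb :: "nat \<Rightarrow> complex poly \<times> complex poly" where
  "cheb k = pell_pow [:-1, 0, 1:] ([:0, 1:], 1) k"

text \<open>The norm on \<open>C[t][sqrt D]\<close> is multiplicative (Brahmagupta's
  identity).\<close>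

lemma pell_pow_norm:
  assumes "a\<^sup>2 - D * b\<^sup>2 = 1" "pell_pow D (a, b) k = (x, y)"
  shows "x\<^sup>2 - D * y\<^sup>2 = 1"
  using assms(2)
proof (induction k arbitrary: x y)
  case (Suc k)
  obtain u v where uv: "pell_pow D (a, b) k = (u, v)" by fastforce
  have xy: "x = a * u + D * b * v" "y = a * v + b * u"
    using Suc.prems uv by (auto simp: pell_mult_def)
  have "x\<^sup>2 - D * y\<^sup>2 = (a\<^sup>2 - D * b\<^sup>2) * (u\<^sup>2 - D * v\<^sup>2)"
    unfolding xy by algebra
  then show ?case by (simp add: assms(1) Suc.IH[OF uv])
qed simp

text \<open>As \<open>D * b^2 = a^2 - 1\<close>, sending \<open>y\<close> to \<open>a\<close> and
  \<open>sqrt (y^2 - 1)\<close> to \<open>b * sqrt D\<close> respects products, so powers of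
  \<open>y + sqrt (y^2 - 1)\<close> go to powers of \<open>a + b * sqrt D\<close>.\<close>

lemma pell_pow_eq_cheb:
  assumes "a\<^sup>2 - D * b\<^sup>2 = 1"
  shows "pell_pow D (a, b) k = (fst (cheb k) \<circ>\<^sub>p a, b * (snd (cheb k) \<circ>\<^sub>p a))"
proof (induction k)
  case 0
  then show ?case by (simp add: cheb_def pcompose_1)
next
  case (Suc k)
  let ?T = "fst (cheb k)" and ?U = "snd (cheb k)"
  have "[:-1, 0, 1:] \<circ>\<^sub>p a = a\<^sup>2 - 1" "[:0, 1:] \<circ>\<^sub>p a = a"
    by (simp_all add: pcompose_pCons power2_eq_square one_pCons)
  then have rec: "fst (cheb (Suc k)) \<circ>\<^sub>p a = a * (?T \<circ>\<^sub>p a) + (a\<^sup>2 - 1) * (?U \<circ>\<^sub>p a)"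
      "snd (cheb (Suc k)) \<circ>\<^sub>p a = a * (?U \<circ>\<^sub>p a) + ?T \<circ>\<^sub>p a"
    by (simp_all add: cheb_def pell_mult_def pcompose_add pcompose_mult
        del: mult_pCons_left mult_pCons_right)
  have norm: "a\<^sup>2 - 1 = D * b\<^sup>2" using assms by (simp add: algebra_simps)
  show ?case
    by (simp only: pell_pow.simps Suc pell_mult_def rec norm fst_conv snd_conv)
       (simp add: algebra_simps power2_eq_square)
qed

lemma cheb_norm: "(fst (cheb k))\<^sup>2 - [:-1, 0, 1:] * (snd (cheb k))\<^sup>2 = 1"
  by (rule pell_pow_norm[of "[:0,1:]" _ 1 k]) (simp_all add: cheb_def power2_eq_square)

lemma degree_cheb: "degree (fst (cheb k)) = k"
proof -
  \<comment> \<open>Carrying the leading coefficients along excludes cancellation between the two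
    terms of top degree. The pattern starts at \<open>Suc k\<close> because
    \<open>snd (cheb 0)\<close> is zero.\<close>
  have "degree (fst (cheb (Suc k))) \<le> Suc k \<and> coeff (fst (cheb (Suc k))) (Suc k) = 2 ^ k \<and>
        degree (snd (cheb (Suc k))) \<le> k \<and> coeff (snd (cheb (Suc k))) k = 2 ^ k" for k
  proof (induction k)
    case 0
    then show ?case by (simp add: cheb_def pell_mult_def)
  next
    case (Suc k)
    let ?T = "fst (cheb (Suc k))" and ?U = "snd (cheb (Suc k))"
    have rec: "fst (cheb (Suc (Suc k))) = pCons 0 ?T + (pCons 0 (pCons 0 ?U) - ?U)"
      "snd (cheb (Suc (Suc k))) = pCons 0 ?U + ?T"
      by (simp_all add: cheb_def pell_mult_def)
    have 0: "coeff ?U (Suc (Suc k)) = 0" using Suc by (auto intro!: coeff_eq_0)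
    have 1: "degree (pCons 0 ?T) \<le> Suc (Suc k)" "degree (pCons 0 (pCons 0 ?U)) \<le> Suc (Suc k)"
      "degree (pCons 0 ?U) \<le> Suc k"
      using Suc by (simp_all add: degree_pCons_eq_if)
    show ?case unfolding rec using Suc 0 1 by (auto intro!: degree_add_le degree_diff_le)
  qed
  then have "degree (fst (cheb (Suc k))) = Suc k" for k
    by (metis le_antisym le_degree power_not_zero zero_neq_numeral)
  then show ?thesis by (cases k) (auto simp: cheb_def)
qed

text \<open>\<open>X^2 - 1\<close> is a quadratic times \<open>Z^2\<close>, so a nonzero
  \<open>Z\<close> would make it nonconstant.\<close>

lemma pell_quadratic_const:
  fixes X Z :: "complex poly"
  assumes "X\<^sup>2 - [:-1, 0, 1:] * Z\<^sup>2 = 1" "degree X = 0"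
  shows "Z = 0" "X \<in> {1, -1}"
proof -
  have e: "[:-1, 0, 1:] * Z\<^sup>2 = X\<^sup>2 - 1" using assms(1) by (simp add: algebra_simps)
  have "degree (X\<^sup>2 - 1) \<le> 0"
    using assms(2) degree_power_le[of X 2] by (intro degree_diff_le) auto
  then have "degree ([:-1, 0, 1:] * Z\<^sup>2) = 0" by (simp only: e)
  then show "Z = 0"
    by (cases "Z = 0") (simp_all add: degree_mult_eq degree_power_eq del: mult_pCons_left)
  then have "X\<^sup>2 = 1" using assms(1) by simp
  then show "X \<in> {1, -1}" by (simp add: power2_eq_1_iff)
qed

text \<open>With \<open>\<epsilon>\<close> the unit given by \<open>cheb k\<close>, one of the quotients of \<open>S + Q \<surd>(y\<^sup>2 - 1)\<close> by
  \<open>\<epsilon>\<close> and by its conjugate has degree zero, so it is \<open>1\<close> or \<open>-1\<close>.\<close>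
lemma pell_quadratic_unique:
  fixes S Q :: "complex poly"
  assumes pell: "S\<^sup>2 - [:-1, 0, 1:] * Q\<^sup>2 = 1" and k: "degree S = k"
  obtains s s' :: complex where "s \<in> {1, -1}" "s' \<in> {1, -1}"
    "S = smult s (fst (cheb k))" "Q = smult s' (snd (cheb k))"
proof -
  define E :: "complex poly" where "E = [:-1, 0, 1:]"
  define T U where "T = fst (cheb k)" and "U = snd (cheb k)"
  have TU: "T\<^sup>2 - E * U\<^sup>2 = 1" using cheb_norm[of k] by (simp add: T_def U_def E_def)
  have degT: "degree T = k" by (simp add: T_def degree_cheb)
  have T0: "T \<noteq> 0" using TU cheb_norm[of k] degT
    by (cases k) (auto simp: T_def cheb_def)
  have S0: "S \<noteq> 0"
  proof
    assume "S = 0"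
    then have "degree ([:-1, 0, 1:] * Q\<^sup>2) = degree (-1 :: complex poly)"
      using pell by (metis diff_0 minus_minus power_zero_numeral)
    then show False using pell \<open>S = 0\<close>
      by (cases "Q = 0") (simp_all add: degree_mult_eq degree_power_eq del: mult_pCons_left)
  qed
  have main: "\<exists>s. s \<in> {1, -1::complex} \<and> S = smult s T \<and> Q' = smult s U"
    if Q': "S\<^sup>2 - E * Q'\<^sup>2 = 1" and big: "2 * k \<le> degree (S * T + E * Q' * U)"
      and nz: "S * T + E * Q' * U \<noteq> 0" for Q'
  proof -
    \<comment> \<open>\<open>X + Z sqrt E\<close> is
      \<open>(S + Q' sqrt E) * (T - U sqrt E)\<close>, the quotient by the unit of
      \<open>cheb k\<close>.\<close>
    define X Z where "X = S * T - E * Q' * U" and "Z = Q' * T - S * U"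
    have XZ: "X\<^sup>2 - E * Z\<^sup>2 = (S\<^sup>2 - E * Q'\<^sup>2) * (T\<^sup>2 - E * U\<^sup>2)"
      unfolding X_def Z_def by algebra
    \<comment> \<open>The product of \<open>X\<close> with its counterpart for the conjugate unit
      has degree at most \<open>2 * k\<close>; if the counterpart already has that degree,
      \<open>X\<close> is constant.\<close>
    have "X * (S * T + E * Q' * U) = S\<^sup>2 * T\<^sup>2 - (E * Q'\<^sup>2) * (E * U\<^sup>2)"
      unfolding X_def by algebra
    also have "E * Q'\<^sup>2 = S\<^sup>2 - 1" using Q' by (simp add: algebra_simps)
    also have "E * U\<^sup>2 = T\<^sup>2 - 1" using TU by (simp add: algebra_simps)
    finally have prod: "X * (S * T + E * Q' * U) = S\<^sup>2 + T\<^sup>2 - 1" by (simp add: algebra_simps)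
    have "degree (S\<^sup>2 + T\<^sup>2 - 1) \<le> 2 * k"
      using k degT S0 T0 by (intro degree_diff_le degree_add_le) (auto simp: degree_power_eq)
    then have "degree X = 0"
      using big nz prod[symmetric] by (cases "X = 0") (auto simp: degree_mult_eq)
    with XZ Q' TU have ZX: "Z = 0" "X \<in> {1, -1}"
      using pell_quadratic_const[of X Z] by (auto simp: E_def)
    have "S = S * (T\<^sup>2 - E * U\<^sup>2)" "Q' = Q' * (T\<^sup>2 - E * U\<^sup>2)" using TU by simp_all
    then have "S = X * T + E * Z * U" "Q' = X * U + Z * T"
      unfolding X_def Z_def by algebra+
    then have "S = X * T" "Q' = X * U" using ZX by simp_all
    then show ?thesis using ZX(2) by (auto intro: exI[of _ 1] exI[of _ "-1"])
  qed
  have ST: "degree (S * T) = 2 * k" using S0 T0 k degT by (simp add: degree_mult_eq)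
  \<comment> \<open>The counterparts for \<open>Q\<close> and \<open>- Q\<close> add up to
    \<open>2 * S * T\<close>, of degree \<open>2 * k\<close>, so one of them has degree at least
    \<open>2 * k\<close>.\<close>
  have sum: "smult 2 (S * T) = (S * T + E * Q * U) + (S * T + E * (- Q) * U)"
    by (simp add: algebra_simps numeral_poly)
  have "(\<exists>s. s \<in> {1, -1::complex} \<and> S = smult s T \<and> Q = smult s U) \<or>
        (\<exists>s. s \<in> {1, -1::complex} \<and> S = smult s T \<and> - Q = smult s U)"
  proof (cases "2 * k \<le> degree (S * T + E * Q * U) \<and> S * T + E * Q * U \<noteq> 0")
    case True
    then show ?thesis using main[of Q] pell by (auto simp: E_def)
  next
    case False
    have "S * T + E * (- Q) * U \<noteq> 0"
    proof
      assume "S * T + E * (- Q) * U = 0"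
      with sum have "smult 2 (S * T) = S * T + E * Q * U" by simp
      with ST False S0 T0 show False
        by (metis degree_smult_eq mult_eq_0_iff order_refl smult_eq_0_iff zero_neq_numeral)
    qed
    moreover have "2 * k \<le> degree (S * T + E * (- Q) * U)"
    proof (rule ccontr)
      assume "\<not> ?thesis"
      then have lt: "degree (S * T + E * (- Q) * U) < 2 * k" by simp
      have "degree (S * T + E * Q * U) < 2 * k" using False lt
        by (cases "S * T + E * Q * U = 0") auto
      then have "degree (smult 2 (S * T)) < 2 * k" unfolding sum
        using lt by (rule degree_add_less)
      then show False using ST by simp
    qed
    ultimately show ?thesis using main[of "- Q"] pell by (auto simp: E_def)
  qed
  then show ?thesis
  proof (elim disjE exE conjE)
    fix s :: complex assume s: "s \<in> {1, -1}" "S = smult s T" "- Q = smult s U"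
    then have "Q = smult (- s) U" by (metis minus_minus smult_minus_left)
    with s show ?thesis using that[of s "- s"] by (auto simp: T_def U_def)
  qed (use that in \<open>auto simp: T_def U_def\<close>)
qed

section \<open>Decompositions of \<open>A^2\<close> and power solutions\<close>

text \<open>The algebraic half of the converse; monodromy enters only through the decomposition
  \<open>dec\<close>.\<close>

lemma pell_power_of_decomposition:
  fixes D A B R g :: "complex poly"
  assumes sq: "squarefree D" and degD: "degree D = 2 * d" and pell: "pell_solution D A B"
    and dec: "A\<^sup>2 = R \<circ>\<^sub>p g" and degR: "degree R = 2 * m" and m: "m > 0"
    and g: "degree g > 0" "d \<le> degree g"
  shows "\<exists>A' B'. pell_solution D A' B' \<and> is_pell_power D A B m A' B'"
proof -
  have AB: "A\<^sup>2 - D * B\<^sup>2 = 1" and B0: "B \<noteq> 0" using pell by (auto simp: pell_solution_def)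
  have D0: "D \<noteq> 0" using sq by auto
  have rsq: "rsquarefree D" by (rule squarefree_imp_rsquarefree[OF sq])
  have R0: "R \<noteq> 0" using degR m by auto
  have A0: "A \<noteq> 0" using dec R0 g pcompose_eq_0[of R g] by auto
  have finR: "finite (odd_roots R)" by (rule finite_odd_roots[OF R0])
  \<comment> \<open>\<open>A^2\<close> has no root of odd order, so the fibres of \<open>g\<close>
    over \<open>odd_roots R\<close> contribute none. Riemann--Hurwitz then leaves fewer than two
    such points, and parity leaves none.\<close>
  have "(\<Sum>y\<in>odd_roots R. card (odd_roots (g - [:y:]))) = 0"
    using card_odd_roots_pcompose[OF R0 g(1)] odd_roots_square[OF A0] by (simp flip: dec)
  then have "card (odd_roots R) * degree g + 2 \<le> 2 * degree g"
    using card_odd_roots_ge[OF g(1) finR] by simp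
  then have "card (odd_roots R) < 2"
    by (metis add_leD1 add_le_same_cancel1 linorder_not_less mult_le_mono1 order_trans not_numeral_le_zero)
  moreover have "even (card (odd_roots R))" using even_card_odd_roots[OF R0] degR by simp
  ultimately have "card (odd_roots R) = 0" by presburger
  then have "odd_roots R = {}" using finR by simp
  then obtain S0 where "R = S0\<^sup>2" by (rule odd_roots_empty_imp_square)
  then have "A\<^sup>2 = (S0 \<circ>\<^sub>p g)\<^sup>2" using dec by (simp add: pcompose_power)
  \<comment> \<open>\<open>S0 o g\<close> equals \<open>A\<close> only up to sign; \<open>S\<close>
    is the square root of \<open>R\<close> with the right sign.\<close>
  then have "A = S0 \<circ>\<^sub>p g \<or> A = (- S0) \<circ>\<^sub>p g" by (simp add: power2_eq_iff pcompose_uminus)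
  moreover have "(- S0)\<^sup>2 = S0\<^sup>2" by simp
  ultimately obtain S where S: "R = S\<^sup>2" "A = S \<circ>\<^sub>p g" using \<open>R = S0\<^sup>2\<close> by metis
  have degS: "degree S = m" using S(1) degR R0 by (auto simp: degree_power_eq)
  define K where "K = S\<^sup>2 - 1"
  have degK: "degree K = 2 * m"
    using degree_add_eq_left[of "-1" "S\<^sup>2"] degR m by (simp add: K_def S(1))
  have K0: "K \<noteq> 0" using degK m by auto
  have Kg: "K \<circ>\<^sub>p g = D * B\<^sup>2"
    using AB by (simp add: K_def pcompose_diff pcompose_power pcompose_1 flip: S(2)) (simp add: algebra_simps)
  have finK: "finite (odd_roots K)" by (rule finite_odd_roots[OF K0])
  \<comment> \<open>\<open>D\<close> has \<open>2 * d\<close> simple roots, and the factor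
    \<open>B^2\<close> does not change the parity of orders.\<close>
  have "card (odd_roots (K \<circ>\<^sub>p g)) = 2 * d"
    unfolding Kg odd_roots_mult_square[OF D0 B0] odd_roots_rsquarefree[OF rsq]
      card_roots_rsquarefree[OF rsq] degD ..
  then have "card (odd_roots K) * degree g + 2 \<le> 2 * d + 2 * degree g"
    using card_odd_roots_ge[OF g(1) finK] card_odd_roots_pcompose[OF K0 g(1)] by simp
  \<comment> \<open>Here \<open>d \<le> degree g\<close> enters: it turns
    \<open>2 * d + 2 * degree g\<close> into at most \<open>4 * degree g\<close>, and the summand 2
    makes the inequality strict.\<close>
  then have "card (odd_roots K) * degree g < 4 * degree g" using g by linarith
  then have lt4: "card (odd_roots K) < 4" by simp
  \<comment> \<open>Riemann--Hurwitz for \<open>S\<close> over the two values \<open>1\<close> and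
    \<open>-1\<close>, since \<open>K = (S - 1) * (S + 1)\<close>.\<close>
  have ge2: "2 \<le> card (odd_roots K)"
  proof -
    have S': "degree S > 0" using degS m by simp
    have K: "K = [:-1, 0, 1:] \<circ>\<^sub>p S" by (simp add: K_def pcompose_pCons power2_eq_square one_pCons)
    have quad: "rsquarefree [:-1, 0, 1 :: complex:]"
      unfolding rsquarefree_roots by (auto simp: pderiv_pCons)
    have "{w::complex. poly [:-1, 0, 1:] w = 0} = {1, -1}"
      by (auto simp: power2_eq_1_iff simp flip: power2_eq_square)
    then have "odd_roots [:-1, 0, 1:] = {1, -1}"
      using odd_roots_rsquarefree[OF quad] by simp
    then have "card (odd_roots K) = (\<Sum>y\<in>{1, -1}. card (odd_roots (S - [:y:])))"
      using card_odd_roots_pcompose[of "[:-1, 0, 1:]" S] S' K by simp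
    then show ?thesis using card_odd_roots_ge[OF S', of "{1, -1}"] by simp
  qed
  have "even (card (odd_roots K))" using even_card_odd_roots[OF K0] degK by simp
  with lt4 ge2 have "card (odd_roots K) = 2" by presburger
  then obtain y1 y2 where y: "odd_roots K = {y1, y2}" "y1 \<noteq> y2" by (auto simp: card_2_iff)
  define M where "M = [:-y1, 1:] * [:-y2, 1:]"
  have M0: "M \<noteq> 0" by (simp add: M_def)
  have "order y [:-y1, 1:] = (if y = y1 then 1 else 0)" "order y [:-y2, 1:] = (if y = y2 then 1 else 0)" for y
    using order_power_n_n[of _ 1] by (auto intro!: order_0I)
  then have ordM: "order y M = (if y \<in> {y1, y2} then 1 else 0)" for y
    unfolding M_def by (subst order_mult) (use y(2) in auto)
  have "poly K y1 = 0" "poly K y2 = 0" using odd_roots_subset[OF K0] y(1) by auto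
  then have "(\<Prod>z\<in>{y1, y2}. [:-z, 1:]) dvd K" by (intro prod_linear_factors_dvd) auto
  then have "M dvd K" using y(2) by (simp add: M_def del: mult_pCons_left mult_pCons_right)
  then obtain N where N: "K = M * N" unfolding dvd_def by blast
  have "odd_roots N = {}"
  proof -
    have sum: "order y K = order y M + order y N" for y unfolding N by (subst order_mult) (use K0 N in auto)
    have odd: "odd (order y K) \<longleftrightarrow> y \<in> {y1, y2}" for y using y(1) by (auto simp: odd_roots_def)
    have "even (order y N)" for y using sum[of y] odd[of y] ordM[of y] by (auto split: if_splits)
    then show ?thesis by (simp add: odd_roots_def)
  qed
  then obtain Q0 where Q0: "N = Q0\<^sup>2" by (rule odd_roots_empty_imp_square)
  \<comment> \<open>The affine map \<open>y \<mapsto> \<beta> + \<alpha> * y\<close> takes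
    \<open>1\<close> to \<open>y1\<close> and \<open>-1\<close> to \<open>y2\<close>;
    \<open>h\<close> is \<open>g\<close> in the new coordinate. The factor \<open>\<alpha>\<close>
    in \<open>Q1\<close> absorbs the \<open>\<alpha>^2\<close> of \<open>M1\<close>.\<close>
  define \<alpha> \<beta> where "\<alpha> = (y1 - y2) / 2" and "\<beta> = (y1 + y2) / 2"
  have \<alpha>0: "\<alpha> \<noteq> 0" using y(2) by (simp add: \<alpha>_def)
  define h where "h = smult (1 / \<alpha>) (g - [:\<beta>:])"
  define S1 where "S1 = S \<circ>\<^sub>p [:\<beta>, \<alpha>:]"
  define Q1 where "Q1 = smult \<alpha> (Q0 \<circ>\<^sub>p [:\<beta>, \<alpha>:])"
  have gh: "[:\<beta>, \<alpha>:] \<circ>\<^sub>p h = g" using \<alpha>0 by (simp add: h_def pcompose_pCons)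
  have M1: "M \<circ>\<^sub>p [:\<beta>, \<alpha>:] = smult (\<alpha>\<^sup>2) [:-1, 0, 1:]"
    by (simp add: M_def pcompose_mult pcompose_pCons \<alpha>_def \<beta>_def power2_eq_square field_simps)
  have "S1\<^sup>2 - 1 = (M * Q0\<^sup>2) \<circ>\<^sub>p [:\<beta>, \<alpha>:]"
    using N by (simp add: S1_def K_def Q0 pcompose_power pcompose_1 flip: pcompose_diff)
       (metis pcompose_1 pcompose_diff pcompose_power)
  also have "\<dots> = [:-1, 0, 1:] * Q1\<^sup>2"
    unfolding pcompose_mult pcompose_power M1 Q1_def smult_power mult_smult_left mult_smult_right ..
  finally have SQ: "S1\<^sup>2 - [:-1, 0, 1:] * Q1\<^sup>2 = 1" by (simp add: algebra_simps)
  have "degree S1 = m" using \<alpha>0 by (simp add: S1_def degree_pcompose degS)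
  with SQ obtain s s' where s: "s \<in> {1, -1}" "s' \<in> {1, -1}"
    "S1 = smult s (fst (cheb m))" "Q1 = smult s' (snd (cheb m))"
    by (metis pell_quadratic_unique)
  have A: "A = S1 \<circ>\<^sub>p h" unfolding S(2) S1_def pcompose_assoc[symmetric] gh ..
  have E: "[:-1, 0, 1:] \<circ>\<^sub>p h = h\<^sup>2 - 1"
    by (simp add: pcompose_pCons power2_eq_square one_pCons)
  define q where "q = Q1 \<circ>\<^sub>p h"
  have "D * B\<^sup>2 = (S1 \<circ>\<^sub>p h)\<^sup>2 - 1" using AB A by (simp add: algebra_simps)
  also have "\<dots> = (S1\<^sup>2 - 1) \<circ>\<^sub>p h" by (simp add: pcompose_diff pcompose_power pcompose_1)
  also have "S1\<^sup>2 - 1 = [:-1, 0, 1:] * Q1\<^sup>2" using SQ by (simp add: algebra_simps)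
  finally have DB: "D * B\<^sup>2 = (h\<^sup>2 - 1) * q\<^sup>2"
    by (simp only: pcompose_mult pcompose_power E q_def)
  then have q0: "q \<noteq> 0" and h0: "h\<^sup>2 - 1 \<noteq> 0" using D0 B0 by auto
  \<comment> \<open>\<open>h^2 - 1\<close> and \<open>D\<close> agree up to square factors; since
    the roots of \<open>D\<close> are simple, \<open>D\<close> divides \<open>h^2 - 1\<close> with a
    square cofactor.\<close>
  have odd_eq: "odd_roots (h\<^sup>2 - 1) = odd_roots D"
    using odd_roots_mult_square[OF D0 B0] odd_roots_mult_square[OF h0 q0] DB by simp
  have ordD: "order w D = (if w \<in> odd_roots D then 1 else 0)" for w
    using rsq unfolding rsquarefree_def odd_roots_def by (auto dest: spec[of _ w])
  have "D dvd h\<^sup>2 - 1"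
  proof (rule dvd_if_distinct_roots[OF D0 card_roots_rsquarefree[OF rsq]])
    fix z assume "poly D z = 0"
    then have "z \<in> odd_roots (h\<^sup>2 - 1)" using odd_eq odd_roots_rsquarefree[OF rsq] by simp
    then show "poly (h\<^sup>2 - 1) z = 0" using odd_roots_subset[OF h0] by auto
  qed
  then obtain N' where N': "h\<^sup>2 - 1 = D * N'" unfolding dvd_def by blast
  have "odd_roots N' = {}"
  proof -
    have sum: "order w (h\<^sup>2 - 1) = order w D + order w N'" for w
      unfolding N' by (subst order_mult) (use h0 N' in auto)
    have odd: "odd (order w (h\<^sup>2 - 1)) \<longleftrightarrow> w \<in> odd_roots D" for w
      unfolding odd_eq[symmetric] by (simp add: odd_roots_def)
    have "even (order w N')" for w using sum[of w] odd[of w] ordD[of w] by (auto split: if_splits)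
    then show ?thesis by (simp add: odd_roots_def)
  qed
  then obtain C where C: "N' = C\<^sup>2" by (rule odd_roots_empty_imp_square)
  have hC: "h\<^sup>2 - D * C\<^sup>2 = 1" using N' C by (simp add: algebra_simps)
  have C0: "C \<noteq> 0" using h0 N' C by auto
  have "D * B\<^sup>2 = D * (C * q)\<^sup>2" using DB N' C by (simp add: power_mult_distrib mult.assoc)
  then have "B\<^sup>2 = (C * q)\<^sup>2" using D0 by simp
  then obtain s'' :: complex where s'': "s'' \<in> {1, -1}" "B = smult s'' (C * q)"
    unfolding power2_eq_iff by (auto intro: that[of 1] that[of "-1"])
  have pq: "A = smult s (fst (cheb m) \<circ>\<^sub>p h)" "B = smult (s'' * s') (C * (snd (cheb m) \<circ>\<^sub>p h))"
    using A s s'' by (simp_all add: q_def pcompose_smult)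
  \<comment> \<open>\<open>s\<close> is the overall sign; the remaining relative sign goes to the
    second coordinate of the base, which enters the power linearly.\<close>
  define s2 where "s2 = s * s'' * s'"
  have s2: "s2 \<in> {1, -1}" "s2 * s = s'' * s'" using s s'' by (auto simp: s2_def)
  have "h\<^sup>2 - D * (smult s2 C)\<^sup>2 = 1" using hC s2(1) by auto
  from pell_pow_eq_cheb[OF this, of m]
  have "(A, B) = (\<lambda>(a, b). (smult s a, smult s b)) (pell_pow D (h, smult s2 C) m)"
    using pq s2 by (simp add: mult.commute)
  then have "is_pell_power D A B m h C" unfolding is_pell_power_def using s(1) s2(1) by blast
  moreover have "pell_solution D h C" using hC C0 by (simp add: pell_solution_def)
  ultimately show ?thesis by blast
qed

text \<open>The sign inside the power affects only the second coordinate, and squaring removes the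
  outer one.\<close>

lemma is_pell_power_imp_cheb:
  assumes "pell_solution D A' B'" "is_pell_power D A B m A' B'"
  shows "A\<^sup>2 = ((fst (cheb m))\<^sup>2) \<circ>\<^sub>p A'"
proof -
  obtain s1 s2 where s: "s1 \<in> {1, -1}" "s2 \<in> {1, -1}"
    "(A, B) = (\<lambda>(a, b). (smult s1 a, smult s1 b)) (pell_pow D (A', smult s2 B') m)"
    using assms(2) unfolding is_pell_power_def by blast
  have "A'\<^sup>2 - D * (smult s2 B')\<^sup>2 = 1" using assms(1) s(2) by (auto simp: pell_solution_def)
  from pell_pow_eq_cheb[OF this, of m] s(3) have "A = smult s1 (fst (cheb m) \<circ>\<^sub>p A')" by simp
  then show ?thesis using s(1) by (auto simp: pcompose_power)
qed

subsection \<open>The covering defined by a polynomial\<close>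

text \<open>Whole fibres over critical values are removed, noncritical points included, so that
  \<open>P\<close> becomes a covering.\<close>

definition regular_points :: "complex poly \<Rightarrow> complex set" where
  "regular_points P = {z. poly P z \<notin> crit_values P}"

lemma finite_fiber: "degree P > 0 \<Longrightarrow> finite (fiber P u)"
  using poly_roots_finite[OF diff_const_nonzero, of P u] by (simp add: fiber_def)

lemma finite_crit_values:
  assumes "degree P > 0"
  shows "finite (crit_values P)"
proof -
  have "pderiv P \<noteq> 0" using assms by (simp add: pderiv_eq_0_iff)
  then have "finite (poly P ` {w. poly (pderiv P) w = 0})" by (intro finite_imageI poly_roots_finite)
  then show ?thesis by (simp add: crit_values_def setcompr_eq_image)
qed

lemma finite_irregular_points:
  assumes "degree P > 0"
  shows "finite (- regular_points P)"
proof -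
  have "- regular_points P = (\<Union>u\<in>crit_values P. fiber P u)"
    by (auto simp: regular_points_def fiber_def)
  then show ?thesis using finite_crit_values[OF assms] finite_fiber[OF assms] by simp
qed

text \<open>A multiple root of \<open>P - u\<close> would be a critical point over
  \<open>u\<close>.\<close>

lemma card_fiber:
  assumes "u \<notin> crit_values P"
  shows "card (fiber P u) = degree P"
proof -
  have "rsquarefree (P - [:u:])"
    using assms by (auto simp: rsquarefree_roots crit_values_def pderiv_diff pderiv_pCons)
  then show ?thesis using card_roots_rsquarefree[of "P - [:u:]"]
    by (simp add: fiber_def degree_diff_const)
qed

text \<open>\<open>P\<close> is locally invertible at each point over \<open>u\<close>, and one disc
  is chosen inside all the images. The sections serve for the covering property and for the
  holomorphy of block products.\<close>

lemma local_sections: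
  assumes P: "degree P > 0" and u: "u \<notin> crit_values P"
  obtains e W s where "e > 0" "ball u e \<inter> crit_values P = {}"
    "\<And>z. z \<in> fiber P u \<Longrightarrow> open (W z) \<and> z \<in> W z \<and> s z holomorphic_on ball u e"
    "\<And>z x. z \<in> fiber P u \<Longrightarrow> x \<in> ball u e \<Longrightarrow> s z x \<in> W z \<and> poly P (s z x) = x"
    "\<And>z w. z \<in> fiber P u \<Longrightarrow> w \<in> W z \<Longrightarrow> poly P w \<in> ball u e \<Longrightarrow> s z (poly P w) = w"
    "\<And>z z'. z \<in> fiber P u \<Longrightarrow> z' \<in> fiber P u \<Longrightarrow> z \<noteq> z' \<Longrightarrow> W z \<inter> W z' = {}"
    "\<And>w. poly P w \<in> ball u e \<Longrightarrow> \<exists>z\<in>fiber P u. w \<in> W z"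
proof -
  let ?F = "fiber P u"
  have finF: "finite ?F" by (rule finite_fiber[OF P])
  have "\<exists>d>0. \<forall>x\<in>?F. x \<noteq> z \<longrightarrow> d \<le> dist z x" for z
    by (rule finite_set_avoid[OF finF])
  then obtain \<delta> where \<delta>: "\<And>z. \<delta> z > 0" "\<And>z x. x \<in> ?F \<Longrightarrow> x \<noteq> z \<Longrightarrow> \<delta> z \<le> dist z x" by metis
  have hol: "poly P holomorphic_on X" for X by (intro holomorphic_intros)
  have deriv: "deriv (poly P) z \<noteq> 0" if "z \<in> ?F" for z
    using that u DERIV_imp_deriv[OF poly_DERIV, of P z] by (auto simp: fiber_def crit_values_def)
  \<comment> \<open>Half of a lower bound for the distance to the other fibre points keeps the
    neighbourhoods disjoint.\<close>
  have "\<exists>r>0. ball z r \<subseteq> ball z (\<delta> z / 2) \<and> open (poly P ` ball z r) \<and> inj_on (poly P) (ball z r)"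
    if "z \<in> ?F" for z
    using has_complex_derivative_locally_invertible[OF hol, of z "ball z (\<delta> z / 2)"] \<delta>(1)[of z] deriv[OF that]
    by (metis centre_in_ball half_gt_zero open_ball)
  then obtain r where r: "\<And>z. z \<in> ?F \<Longrightarrow> r z > 0 \<and> ball z (r z) \<subseteq> ball z (\<delta> z / 2) \<and>
      open (poly P ` ball z (r z)) \<and> inj_on (poly P) (ball z (r z))" by metis
  define W where "W z = ball z (r z)" for z
  have "\<exists>g. g holomorphic_on (poly P ` W z) \<and> (\<forall>w\<in>W z. g (poly P w) = w)" if "z \<in> ?F" for z
    using holomorphic_has_inverse[OF hol, of "W z"] r[OF that] unfolding W_def by (metis open_ball)
  then obtain s where s: "\<And>z. z \<in> ?F \<Longrightarrow> s z holomorphic_on (poly P ` W z)"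
      "\<And>z w. z \<in> ?F \<Longrightarrow> w \<in> W z \<Longrightarrow> s z (poly P w) = w" by metis
  define O' where "O' = (\<Inter>z\<in>?F. poly P ` W z) \<inter> - crit_values P"
  have "open O'" unfolding O'_def using finF r finite_crit_values[OF P]
    by (intro open_Int open_INT) (auto simp: W_def finite_imp_closed open_Compl)
  moreover have "u \<in> O'" using u r by (force simp: O'_def W_def fiber_def)
  ultimately obtain e where e: "e > 0" "ball u e \<subseteq> O'" by (meson openE)
  have sub: "ball u e \<subseteq> poly P ` W z" if "z \<in> ?F" for z using e(2) that by (auto simp: O'_def)
  have sec: "s z x \<in> W z \<and> poly P (s z x) = x" if zx: "z \<in> ?F" "x \<in> ball u e" for z x
  proof -
    obtain w where "w \<in> W z" "x = poly P w" using sub[OF zx(1)] zx(2) by blast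
    then show ?thesis using s(2)[OF zx(1)] by simp
  qed
  have disj: "W z \<inter> W z' = {}" if z: "z \<in> ?F" "z' \<in> ?F" "z \<noteq> z'" for z z'
  proof (rule ccontr)
    assume "W z \<inter> W z' \<noteq> {}"
    then obtain w where "w \<in> ball z (\<delta> z / 2)" "w \<in> ball z' (\<delta> z' / 2)"
      using r z unfolding W_def by blast
    then have "2 * dist z w < \<delta> z" "2 * dist z' w < \<delta> z'" by auto
    moreover have "\<delta> z \<le> dist z z'" "\<delta> z' \<le> dist z' z" using \<delta>(2) z by auto
    moreover have "dist z z' \<le> dist z w + dist z' w" by (metis dist_commute dist_triangle)
    ultimately show False by (simp add: dist_commute)
  qed
  \<comment> \<open>The sections give \<open>degree P\<close> distinct preimages and the fibre has
    no more, so every preimage lies on a sheet.\<close>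
  have cover: "\<exists>z\<in>?F. w \<in> W z" if w: "poly P w \<in> ball u e" for w
  proof -
    let ?S = "(\<lambda>z. s z (poly P w)) ` ?F"
    have "inj_on (\<lambda>z. s z (poly P w)) ?F"
      using sec[OF _ w] disj by (intro inj_onI) (metis disjoint_iff)
    then have "card ?S = degree P" using card_fiber[OF u] by (simp add: card_image)
    moreover have "poly P w \<notin> crit_values P" using w e(2) by (auto simp: O'_def)
    then have "card (fiber P (poly P w)) = degree P" by (rule card_fiber)
    moreover have "?S \<subseteq> fiber P (poly P w)" using sec[OF _ w] by (auto simp: fiber_def)
    ultimately have "?S = fiber P (poly P w)" by (metis card_subset_eq finite_fiber[OF P])
    moreover have "w \<in> fiber P (poly P w)" by (simp add: fiber_def)
    ultimately obtain z where "z \<in> ?F" "w = s z (poly P w)" by blast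
    then show ?thesis using sec[OF _ w, of z] by metis
  qed
  show ?thesis
  proof (rule that[of e W s])
    show "ball u e \<inter> crit_values P = {}" using e(2) by (auto simp: O'_def)
    show "open (W z) \<and> z \<in> W z \<and> s z holomorphic_on ball u e" if "z \<in> ?F" for z
      using r[OF that] holomorphic_on_subset[OF s(1) sub] that by (simp add: W_def)
  qed (use e(1) sec s(2) disj cover in blast)+
qed

lemma covering_space_regular:
  assumes P: "degree P > 0"
  shows "covering_space (regular_points P) (poly P) (- crit_values P)"
  unfolding covering_space_def
proof (intro conjI ballI)
  show "continuous_on (regular_points P) (poly P)" by (intro continuous_intros)
  show "poly P ` regular_points P = - crit_values P"
  proof (intro equalityI subsetI)
    fix u assume "u \<in> - crit_values P"
    then have "card (fiber P u) > 0" using card_fiber P by simp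
    then obtain z where "z \<in> fiber P u" by (metis card.empty ex_in_conv less_irrefl)
    then show "u \<in> poly P ` regular_points P"
      using \<open>u \<in> - crit_values P\<close> by (auto simp: fiber_def regular_points_def)
  qed (auto simp: regular_points_def)
  fix u assume "u \<in> - crit_values P"
  then have u: "u \<notin> crit_values P" by simp
  obtain e W s where e: "e > 0" "ball u e \<inter> crit_values P = {}"
    and W: "\<And>z. z \<in> fiber P u \<Longrightarrow> open (W z) \<and> z \<in> W z \<and> s z holomorphic_on ball u e"
    and sec: "\<And>z x. z \<in> fiber P u \<Longrightarrow> x \<in> ball u e \<Longrightarrow> s z x \<in> W z \<and> poly P (s z x) = x"
    and ret: "\<And>z w. z \<in> fiber P u \<Longrightarrow> w \<in> W z \<Longrightarrow> poly P w \<in> ball u e \<Longrightarrow> s z (poly P w) = w"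
    and disj: "\<And>z z'. z \<in> fiber P u \<Longrightarrow> z' \<in> fiber P u \<Longrightarrow> z \<noteq> z' \<Longrightarrow> W z \<inter> W z' = {}"
    and cover: "\<And>w. poly P w \<in> ball u e \<Longrightarrow> \<exists>z\<in>fiber P u. w \<in> W z"
    by (rule local_sections[OF P u]) blast
  let ?pre = "poly P -` ball u e"
  have "open ?pre" by (intro open_vimage continuous_intros) auto
  \<comment> \<open>The sheets: each \<open>W z\<close> cut down to the preimage of the
    disc.\<close>
  let ?v = "(\<lambda>z. W z \<inter> ?pre) ` fiber P u"
  show "\<exists>T. u \<in> T \<and> openin (top_of_set (- crit_values P)) T \<and>
      (\<exists>v. \<Union> v = regular_points P \<inter> poly P -` T \<and>
        (\<forall>x\<in>v. openin (top_of_set (regular_points P)) x) \<and> pairwise disjnt v \<and>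
        (\<forall>x\<in>v. \<exists>g. homeomorphism x T (poly P) g))"
  proof (intro exI[of _ "ball u e"] conjI exI[of _ ?v] ballI)
    show "u \<in> ball u e" using e by simp
    show "openin (top_of_set (- crit_values P)) (ball u e)"
      using e by (auto intro!: open_subset)
    show "\<Union> ?v = regular_points P \<inter> ?pre"
      using cover e(2) by (auto simp: regular_points_def)
    show "pairwise disjnt ?v" using disj by (auto simp: pairwise_def disjnt_def)
    fix x assume "x \<in> ?v"
    then obtain z where z: "z \<in> fiber P u" "x = W z \<inter> ?pre" by blast
    show "openin (top_of_set (regular_points P)) x"
      using z W e(2) \<open>open ?pre\<close> by (intro open_subset) (auto simp: regular_points_def)
    have "homeomorphism x (ball u e) (poly P) (s z)"
    proof (rule homeomorphismI)
      show "continuous_on x (poly P)" by (intro continuous_intros)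
      show "continuous_on (ball u e) (s z)" using W z by (blast intro: holomorphic_on_imp_continuous_on)
    qed (use z sec ret in auto)
    then show "\<exists>g. homeomorphism x (ball u e) (poly P) g" by blast
  qed
qed

section \<open>Path lifting and the monodromy action\<close>

text \<open>The lifting clause of \<open>monodromy_group\<close>, as a relation between the
  endpoints of a lift; existence and uniqueness off the critical values come from the
  covering.\<close>

definition lifts :: "complex poly \<Rightarrow> (real \<Rightarrow> complex) \<Rightarrow> complex \<Rightarrow> complex \<Rightarrow> bool" where
  "lifts P \<gamma> z w \<longleftrightarrow> (\<exists>p. path p \<and> pathstart p = z \<and>
     (\<forall>t\<in>{0..1}. poly P (p t) = \<gamma> t) \<and> pathfinish p = w)"

lemma lifts_start: "lifts P \<gamma> z w \<Longrightarrow> poly P z = pathstart \<gamma>"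
  by (auto simp: lifts_def pathstart_def)

lemma lifts_finish: "lifts P \<gamma> z w \<Longrightarrow> poly P w = pathfinish \<gamma>"
  by (auto simp: lifts_def pathfinish_def)

lemma lifts_exists:
  assumes "degree P > 0" "path \<gamma>" "path_image \<gamma> \<inter> crit_values P = {}" "poly P z = pathstart \<gamma>"
  obtains w where "lifts P \<gamma> z w"
proof -
  have z: "z \<in> regular_points P" using assms pathstart_in_path_image[of \<gamma>] by (auto simp: regular_points_def)
  have "path_image \<gamma> \<subseteq> - crit_values P" using assms(3) by auto
  then obtain h where "path h" "pathstart h = z" "\<And>t. t \<in> {0..1} \<Longrightarrow> poly P (h t) = \<gamma> t"
    using covering_space_lift_path_strong[OF covering_space_regular[OF assms(1)] z assms(2)] assms(4) by metis
  then have "lifts P \<gamma> z (pathfinish h)" by (auto simp: lifts_def)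
  then show ?thesis by (rule that)
qed

lemma lifts_unique:
  assumes "degree P > 0" "path \<gamma>" "path_image \<gamma> \<inter> crit_values P = {}" "lifts P \<gamma> z w" "lifts P \<gamma> z w'"
  shows "w = w'"
proof -
  obtain p where p: "path p" "pathstart p = z" "\<And>t. t \<in> {0..1} \<Longrightarrow> poly P (p t) = \<gamma> t" "pathfinish p = w"
    using assms(4) by (auto simp: lifts_def)
  obtain p' where p': "path p'" "pathstart p' = z" "\<And>t. t \<in> {0..1} \<Longrightarrow> poly P (p' t) = \<gamma> t" "pathfinish p' = w'"
    using assms(5) by (auto simp: lifts_def)
  have \<gamma>: "\<gamma> t \<notin> crit_values P" if "t \<in> {0..1}" for t using assms(3) that unfolding path_image_def by blast
  have "p 1 = p' 1"
  proof (rule covering_space_lift_unique[OF covering_space_regular[OF assms(1)], of p 0 p' "{0..1}" \<gamma>])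
    show "p 0 = p' 0" using p(2) p'(2) by (simp add: pathstart_def)
  qed (use p(1,3) p'(1,3) assms(2) \<gamma> in \<open>auto simp: path_def regular_points_def\<close>)
  then show ?thesis using p(4) p'(4) by (simp add: pathfinish_def)
qed

lemma lifts_reversepath:
  assumes "lifts P \<gamma> z w"
  shows "lifts P (reversepath \<gamma>) w z"
proof -
  obtain p where p: "path p" "pathstart p = z" "\<forall>t\<in>{0..1}. poly P (p t) = \<gamma> t" "pathfinish p = w"
    using assms by (auto simp: lifts_def)
  then show ?thesis unfolding lifts_def
    by (intro exI[of _ "reversepath p"]) (auto, auto simp: reversepath_def)
qed

lemma lifts_join:
  assumes "lifts P \<gamma> z w" "lifts P \<gamma>' w x"
  shows "lifts P (\<gamma> +++ \<gamma>') z x"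
proof -
  obtain p where p: "path p" "pathstart p = z" "\<forall>t\<in>{0..1}. poly P (p t) = \<gamma> t" "pathfinish p = w"
    using assms(1) by (auto simp: lifts_def)
  obtain p' where p': "path p'" "pathstart p' = w" "\<forall>t\<in>{0..1}. poly P (p' t) = \<gamma>' t" "pathfinish p' = x"
    using assms(2) by (auto simp: lifts_def)
  show ?thesis unfolding lifts_def
  proof (intro exI[of _ "p +++ p'"] conjI ballI)
    show "poly P ((p +++ p') t) = (\<gamma> +++ \<gamma>') t" if "t \<in> {0..1}" for t
      using that p(3) p'(3) by (simp add: joinpaths_def)
  qed (use p(1,2,4) p'(1,2,4) in simp_all)
qed

text \<open>Lifts of the reversed path are unique as well.\<close>

lemma lifts_inj:
  assumes "degree P > 0" "path \<gamma>" "path_image \<gamma> \<inter> crit_values P = {}" "lifts P \<gamma> z w" "lifts P \<gamma> z' w"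
  shows "z = z'"
proof (rule lifts_unique[OF assms(1)])
  show "lifts P (reversepath \<gamma>) w z" "lifts P (reversepath \<gamma>) w z'"
    using assms(4,5) by (auto intro: lifts_reversepath)
qed (use assms(2,3) in auto)

lemma lifts_pcompose:
  assumes "lifts (R \<circ>\<^sub>p g) \<gamma> z w"
  shows "lifts R \<gamma> (poly g z) (poly g w)"
proof -
  obtain p where p: "path p" "pathstart p = z" "\<forall>t\<in>{0..1}. poly (R \<circ>\<^sub>p g) (p t) = \<gamma> t" "pathfinish p = w"
    using assms by (auto simp: lifts_def)
  have "path (poly g \<circ> p)" using p(1) by (intro path_continuous_image continuous_intros)
  then show ?thesis unfolding lifts_def
    by (intro exI[of _ "poly g \<circ> p"]) (use p in \<open>auto simp: poly_pcompose pathstart_def pathfinish_def\<close>)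
qed

lemma mem_monodromy_group:
  "\<sigma> \<in> monodromy_group P q \<longleftrightarrow> (\<exists>\<gamma>. path \<gamma> \<and> pathstart \<gamma> = q \<and> pathfinish \<gamma> = q \<and>
     path_image \<gamma> \<inter> crit_values P = {} \<and> (\<forall>z\<in>fiber P q. lifts P \<gamma> z (\<sigma> z)) \<and>
     (\<forall>z. z \<notin> fiber P q \<longrightarrow> \<sigma> z = z))"
  by (simp only: monodromy_group_def lifts_def mem_Collect_eq)

lemma loop_induces_monodromy:
  assumes P: "degree P > 0" and \<gamma>: "path \<gamma>" "pathstart \<gamma> = q" "pathfinish \<gamma> = q"
    "path_image \<gamma> \<inter> crit_values P = {}"
  obtains \<sigma> where "\<sigma> \<in> monodromy_group P q" "\<And>z. z \<in> fiber P q \<Longrightarrow> lifts P \<gamma> z (\<sigma> z)"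
proof -
  have "\<exists>w. lifts P \<gamma> z w" if "z \<in> fiber P q" for z
    using lifts_exists[OF P \<gamma>(1,4), of z] that \<gamma>(2) by (auto simp: fiber_def)
  then obtain \<tau> where \<tau>: "\<And>z. z \<in> fiber P q \<Longrightarrow> lifts P \<gamma> z (\<tau> z)" by metis
  \<comment> \<open>The identity outside the fibre, as \<open>monodromy_group\<close>
    requires.\<close>
  define \<sigma> where "\<sigma> z = (if z \<in> fiber P q then \<tau> z else z)" for z
  have "\<sigma> \<in> monodromy_group P q" unfolding mem_monodromy_group
    using \<gamma> \<tau> by (intro exI[of _ \<gamma>]) (auto simp: \<sigma>_def)
  then show ?thesis using that \<tau> by (auto simp: \<sigma>_def)
qed

text \<open>\<open>g\<close> is onto, and by the chain rule every point over a critical point of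
  \<open>R\<close> is critical for \<open>R o g\<close>. Loops admissible for the composite are thus
  admissible for \<open>R\<close>.\<close>

lemma crit_values_pcompose_outer:
  assumes "degree g > 0"
  shows "crit_values R \<subseteq> crit_values (R \<circ>\<^sub>p g)"
proof
  fix u assume "u \<in> crit_values R"
  then obtain y where y: "u = poly R y" "poly (pderiv R) y = 0" by (auto simp: crit_values_def)
  have "\<not> constant (poly (g - [:y:]))"
    using assms constant_degree[of "g - [:y:]"] by (simp add: degree_diff_const)
  then obtain w where "poly (g - [:y:]) w = 0" using fundamental_theorem_of_algebra by blast
  then have "poly g w = y" by simp
  then show "u \<in> crit_values (R \<circ>\<^sub>p g)" using y
    by (auto simp: crit_values_def pderiv_pcompose poly_pcompose intro!: exI[of _ w])
qed

text \<open>The blocks are the fibres of \<open>g\<close> over \<open>fiber R q\<close>. As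
  \<open>g\<close> maps lifts through \<open>R o g\<close> to lifts through \<open>R\<close>, a loop
  permutes these blocks the way it permutes \<open>fiber R q\<close>.\<close>

lemma imprimitive_if_decomposition:
  fixes R g :: "complex poly"
  assumes R: "degree R > 0" and g: "degree g > 0" and q: "q \<notin> crit_values (R \<circ>\<^sub>p g)"
  shows "imprimitive (degree R) (monodromy_group (R \<circ>\<^sub>p g) q) (fiber (R \<circ>\<^sub>p g) q)"
proof -
  let ?P = "R \<circ>\<^sub>p g" and ?Q = "fiber g ` fiber R q"
  have P: "degree ?P > 0" using R g by (simp add: degree_pcompose)
  have crit: "crit_values R \<subseteq> crit_values ?P" by (rule crit_values_pcompose_outer[OF g])
  have cardb: "card (fiber g y) = degree g" if "y \<in> fiber R q" for y
  proof (rule card_fiber)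
    \<comment> \<open>A critical point of \<open>g\<close> over \<open>y\<close> would be critical
      for the composite, over \<open>q\<close>.\<close>
    show "y \<notin> crit_values g" using that q
      by (auto simp: crit_values_def fiber_def pderiv_pcompose poly_pcompose)
  qed
  have ne: "fiber g y \<noteq> {}" if "y \<in> fiber R q" for y using cardb[OF that] g by auto
  have part: "partition_on (fiber ?P q) ?Q"
  proof (rule partition_onI)
    show "\<Union> ?Q = fiber ?P q" by (auto simp: fiber_def poly_pcompose)
    show "disjnt b b'" if b: "b \<in> ?Q" "b' \<in> ?Q" "b \<noteq> b'" for b b'
    proof -
      obtain y y' where "b = fiber g y" "b' = fiber g y'" using b by blast
      then show ?thesis using b(3) by (auto simp: disjnt_def fiber_def)
    qed
    show "{} \<notin> ?Q" using ne by blast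
  qed
  have "inj_on (fiber g) (fiber R q)"
  proof (rule inj_onI)
    fix y y' assume y: "y \<in> fiber R q" "fiber g y = fiber g y'"
    then obtain z where "z \<in> fiber g y" "z \<in> fiber g y'" using ne by blast
    then show "y = y'" by (simp add: fiber_def)
  qed
  then have cardQ: "card ?Q = degree R" using card_fiber[of q R] q crit by (auto simp: card_image)
  have "card (fiber ?P q) = degree R * degree g" using card_fiber[OF q] by (simp add: degree_pcompose)
  then have div: "card (fiber ?P q) div degree R = degree g" using R by simp
  have "\<sigma> ` b \<in> ?Q" if \<sigma>: "\<sigma> \<in> monodromy_group ?P q" and b: "b \<in> ?Q" for \<sigma> b
  proof -
    obtain \<gamma> where \<gamma>: "path \<gamma>" "pathstart \<gamma> = q" "pathfinish \<gamma> = q" "path_image \<gamma> \<inter> crit_values ?P = {}"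
        and \<sigma>': "\<And>z. z \<in> fiber ?P q \<Longrightarrow> lifts ?P \<gamma> z (\<sigma> z)"
      using \<sigma> unfolding mem_monodromy_group by blast
    have \<gamma>R: "path_image \<gamma> \<inter> crit_values R = {}" using \<gamma>(4) crit by auto
    obtain y where y: "y \<in> fiber R q" "b = fiber g y" using b by blast
    have bF: "b \<subseteq> fiber ?P q" using y by (auto simp: fiber_def poly_pcompose)
    obtain y' where y': "lifts R \<gamma> y y'"
      using lifts_exists[OF R \<gamma>(1) \<gamma>R] y(1) \<gamma>(2) by (auto simp: fiber_def)
    have y'F: "y' \<in> fiber R q" using lifts_finish[OF y'] \<gamma>(3) by (simp add: fiber_def)
    have "\<sigma> z \<in> fiber g y'" if "z \<in> b" for z
    proof -
      have "lifts R \<gamma> (poly g z) (poly g (\<sigma> z))" using that bF \<sigma>' by (intro lifts_pcompose) auto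
      moreover have "poly g z = y" using that y by (simp add: fiber_def)
      ultimately show ?thesis using lifts_unique[OF R \<gamma>(1) \<gamma>R y'] by (simp add: fiber_def)
    qed
    then have "\<sigma> ` b \<subseteq> fiber g y'" by blast
    \<comment> \<open>Injectivity and equal cardinalities turn the inclusion into an
      equality.\<close>
    moreover have "inj_on \<sigma> b" using lifts_inj[OF P \<gamma>(1,4)] \<sigma>' bF by (intro inj_onI) (metis subsetD)
    then have "card (\<sigma> ` b) = card (fiber g y')" using cardb y y'F by (simp add: card_image)
    ultimately have "\<sigma> ` b = fiber g y'" by (metis card_subset_eq finite_fiber[OF g])
    then show ?thesis using y'F by blast
  qed
  then show ?thesis unfolding imprimitive_def
    by (intro exI[of _ ?Q]) (use part cardQ div cardb in auto)
qed

subsection \<open>Decomposition from an invariant partition\<close>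

text \<open>The fibre of \<open>g\<close> through \<open>z\<close> has full size, so
  \<open>g - g(z)\<close> divides \<open>p - p(z)\<close>; the quotient has smaller degree and is
  again constant on fibres, which allows induction.\<close>

lemma poly_decomposition_if_const_on_fibers:
  fixes p g :: "complex poly"
  assumes g: "degree g > 0" and "infinite V"
    and "\<And>z. z \<in> V \<Longrightarrow> card {w. poly g w = poly g z} = degree g"
    and "\<And>z w. z \<in> V \<Longrightarrow> poly g w = poly g z \<Longrightarrow> poly p w = poly p z"
  shows "\<exists>R. p = R \<circ>\<^sub>p g"
  using assms(2-)
proof (induction "degree p" arbitrary: p V rule: less_induct)
  case less
  show ?case
  proof (cases "degree p = 0")
    case True
    then obtain a where "p = [:a:]" by (rule degree_eq_zeroE)
    then have "p = [:a:] \<circ>\<^sub>p g" by simp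
    then show ?thesis by blast
  next
    case False
    obtain z where z: "z \<in> V" using less.prems(1) by (metis ex_in_conv finite.emptyI)
    let ?g = "g - [:poly g z:]" and ?p = "p - [:poly p z:]"
    have g0: "?g \<noteq> 0" by (rule diff_const_nonzero[OF g])
    have card: "card {w. poly ?g w = 0} = degree ?g" using less.prems(2)[OF z] by (simp add: degree_diff_const)
    have "?g dvd ?p"
    proof (rule dvd_if_distinct_roots[OF g0 card])
      fix w assume "poly ?g w = 0"
      then show "poly ?p w = 0" using less.prems(3)[OF z, of w] by simp
    qed
    then obtain u where u: "?p = ?g * u" unfolding dvd_def by blast
    have "?p \<noteq> 0" using False diff_const_nonzero[of p] by simp
    then have "degree (?g * u) = degree ?g + degree u"
      using u by (intro degree_mult_eq) auto
    then have "degree p = degree g + degree u" by (simp only: degree_diff_const flip: u)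
    then have lt: "degree u < degree p" using g by simp
    \<comment> \<open>Dropping the fibre through \<open>z\<close> allows cancelling
      \<open>g - g(z)\<close>, and an infinite set remains.\<close>
    let ?V = "V - {w. poly ?g w = 0}"
    have "\<exists>R. u = R \<circ>\<^sub>p g"
    proof (rule less.hyps[OF lt, of ?V])
      show "infinite ?V" using less.prems(1) poly_roots_finite[OF g0] by simp
      show "card {w. poly g w = poly g x} = degree g" if "x \<in> ?V" for x
        using that less.prems(2) by blast
      fix x w assume x: "x \<in> ?V" and w: "poly g w = poly g x"
      have "poly ?p w = poly ?p x" using less.prems(3)[of x w] x w by simp
      then have "poly ?g w * poly u w = poly ?g x * poly u x" by (simp only: u poly_mult)
      moreover have "poly ?g w = poly ?g x" "poly ?g x \<noteq> 0" using w x by auto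
      ultimately show "poly u w = poly u x" by simp
    qed
    then obtain R where "u = R \<circ>\<^sub>p g" by blast
    then have "p = ([:poly p z:] + [:-poly g z, 1:] * R) \<circ>\<^sub>p g"
      unfolding pcompose_add pcompose_mult pcompose_linear pcompose_const
      using u by (simp add: algebra_simps)
    then show ?thesis by blast
  qed
qed

section \<open>Growth estimates and polynomiality\<close>

text \<open>For large \<open>w\<close>, \<open>|P(w)|\<close> is at least a constant times
  \<open>|w|^n\<close>, while \<open>|P(z)|\<close> is at most a constant times
  \<open>(1 + |z|)^n\<close>; compare and take \<open>n\<close>-th roots.\<close>

lemma poly_fiber_norm_bound:
  fixes P :: "complex poly"
  assumes P: "degree P > 0"
  obtains C where "C \<ge> 0" "\<And>z w. poly P w = poly P z \<Longrightarrow> norm w \<le> C * (1 + norm z)"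
proof -
  let ?n = "degree P"
  define l where "l = norm (lead_coeff P)"
  define K where "K = (\<Sum>i\<le>?n. norm (coeff P i))"
  have l: "l > 0" using P by (auto simp: l_def)
  have K0: "K \<ge> 0" by (simp add: K_def sum_nonneg)
  have upper: "norm (poly P z) \<le> K * (1 + norm z) ^ ?n" for z
  proof -
    have "norm (poly P z) \<le> (\<Sum>i\<le>?n. norm (coeff P i * z ^ i))"
      unfolding poly_altdef by (rule norm_sum)
    also have "\<dots> \<le> (\<Sum>i\<le>?n. norm (coeff P i) * (1 + norm z) ^ ?n)"
    proof (rule sum_mono)
      fix i assume "i \<in> {..?n}"
      have "norm z ^ i \<le> (1 + norm z) ^ i" by (rule power_mono) auto
      also have "\<dots> \<le> (1 + norm z) ^ ?n" using \<open>i \<in> _\<close> by (intro power_increasing) auto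
      finally show "norm (coeff P i * z ^ i) \<le> norm (coeff P i) * (1 + norm z) ^ ?n"
        by (simp add: norm_mult norm_power mult_left_mono)
    qed
    finally show ?thesis by (simp add: K_def sum_distrib_right)
  qed
  have "((\<lambda>x. norm (poly P x / x ^ ?n)) \<longlongrightarrow> l) at_infinity"
    unfolding l_def by (intro tendsto_norm poly_divide_tendsto_aux)
  then have "eventually (\<lambda>x. norm (poly P x / x ^ ?n) > l / 2) at_infinity"
    using l by (intro order_tendstoD) auto
  then obtain b where b: "\<And>x. b \<le> norm x \<Longrightarrow> norm (poly P x / x ^ ?n) > l / 2"
    unfolding eventually_at_infinity by blast
  \<comment> \<open>\<open>c \<ge> 1\<close> gives \<open>c \<le> c^n\<close>, so the root can be
    taken; the summand \<open>|b|\<close> in the final constant covers the \<open>w\<close> below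
    the threshold.\<close>
  define c where "c = max 1 (2 * K / l)"
  have c1: "c \<ge> 1" by (simp add: c_def)
  show ?thesis
  proof (rule that[of "c + \<bar>b\<bar>"])
    show "c + \<bar>b\<bar> \<ge> 0" using c1 by simp
    fix z w assume eq: "poly P w = poly P z"
    show "norm w \<le> (c + \<bar>b\<bar>) * (1 + norm z)"
    proof (cases "\<bar>b\<bar> < norm w")
      case False
      then have "norm w \<le> (c + \<bar>b\<bar>) * 1" using c1 by simp
      also have "\<dots> \<le> (c + \<bar>b\<bar>) * (1 + norm z)" using c1 by (intro mult_left_mono) auto
      finally show ?thesis .
    next
      case True
      then have w: "norm w > 0" by linarith
      have "l / 2 < norm (poly P w) / norm w ^ ?n" using b[of w] True by (simp add: norm_divide norm_power)
      then have "l / 2 * norm w ^ ?n < norm (poly P w)" using w by (simp add: field_simps)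
      also have "\<dots> \<le> K * (1 + norm z) ^ ?n" unfolding eq by (rule upper)
      finally have "norm w ^ ?n \<le> 2 * K / l * (1 + norm z) ^ ?n" using l by (simp add: field_simps)
      also have "\<dots> \<le> c * (1 + norm z) ^ ?n" by (intro mult_right_mono) (auto simp: c_def)
      also have "\<dots> \<le> c ^ ?n * (1 + norm z) ^ ?n"
        using c1 P by (intro mult_right_mono self_le_power) auto
      finally have "norm w ^ ?n \<le> (c * (1 + norm z)) ^ ?n" by (simp add: power_mult_distrib)
      then have "norm w \<le> c * (1 + norm z)" using P c1 by (subst (asm) power_mono_iff) auto
      also have "\<dots> \<le> (c + \<bar>b\<bar>) * (1 + norm z)" by (intro mult_right_mono) auto
      finally show ?thesis .
    qed
  qed
qed

text \<open>Multiplying by \<open>L\<close> forces the limit zero at the exceptional points, so they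
  are removable. Liouville's theorem makes the product a polynomial, and dividing out
  \<open>L\<close> restores the degree bound \<open>r\<close>.\<close>

lemma holomorphic_polynomial_growth_imp_poly:
  fixes f :: "complex \<Rightarrow> complex"
  assumes K: "finite K" and f: "f holomorphic_on - K" and M: "M \<ge> 0"
    and bound: "\<And>z. z \<notin> K \<Longrightarrow> norm (f z) \<le> M * (1 + norm z) ^ r"
  obtains G :: "complex poly" where "degree G \<le> r" "\<And>z. z \<notin> K \<Longrightarrow> poly G z = f z"
proof -
  define L where "L = (\<Prod>k\<in>K. [:-k, 1:])"
  define h where "h z = (if z \<in> K then 0 else f z * poly L z)" for z
  have L: "poly L z = (\<Prod>k\<in>K. z - k)" for z by (simp add: L_def poly_prod)
  have L0: "poly L z = 0 \<longleftrightarrow> z \<in> K" for z using K by (auto simp: L)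
  have Lnz: "L \<noteq> 0" using K by (auto simp: L_def)
  have degL: "degree L = card K" unfolding L_def by (subst degree_prod_eq_sum_degree) auto
  have hb: "norm (h z) \<le> M * (1 + norm z) ^ r * norm (poly L z)" for z
    using bound[of z] M by (auto simp: h_def norm_mult intro: mult_right_mono)
  have "open (- K)" using K by (simp add: finite_imp_closed open_Compl)
  have hol: "h holomorphic_on UNIV"
  proof (rule no_isolated_singularity'[OF _ _ open_UNIV K])
    have "(\<lambda>z. f z * poly L z) holomorphic_on - K" using f by (intro holomorphic_intros)
    then show "h holomorphic_on UNIV - K"
      by (rule holomorphic_transform[THEN holomorphic_on_subset]) (auto simp: h_def)
    fix k assume k: "k \<in> K"
    have "((\<lambda>z. M * (1 + norm z) ^ r * norm (poly L z)) \<longlongrightarrow> M * (1 + norm k) ^ r * norm (poly L k)) (at k)"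
      by (intro tendsto_intros)
    then have "((\<lambda>z. M * (1 + norm z) ^ r * norm (poly L z)) \<longlongrightarrow> 0) (at k)"
      using L0[of k] k by simp
    then have "(h \<longlongrightarrow> 0) (at k)"
      by (rule Lim_null_comparison[rotated]) (simp add: hb)
    then show "(h \<longlongrightarrow> h k) (at k)" using k by (simp add: h_def)
  qed
  define n where "n = r + card K"
  define B where "B = M * 2 ^ r * (\<Prod>k\<in>K. 1 + norm k)"
  have growth: "norm (h z) \<le> B * norm z ^ n" if z: "1 \<le> norm z" for z
  proof -
    have "(1 + norm z) ^ r \<le> (2 * norm z) ^ r" using z by (intro power_mono) auto
    moreover have "norm (poly L z) \<le> (\<Prod>k\<in>K. (1 + norm k) * norm z)"
      unfolding L prod_norm[symmetric]
    proof (intro prod_mono conjI)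
      fix k assume "k \<in> K"
      have "norm (z - k) \<le> norm z + norm k" by (rule norm_triangle_ineq4)
      also have "\<dots> \<le> (1 + norm k) * norm z" using z mult_left_mono[OF z, of "norm k"] by (simp add: algebra_simps)
      finally show "norm (z - k) \<le> (1 + norm k) * norm z" .
    qed simp
    ultimately have "M * (1 + norm z) ^ r * norm (poly L z)
        \<le> M * (2 * norm z) ^ r * (\<Prod>k\<in>K. (1 + norm k) * norm z)"
      using M by (intro mult_mono mult_nonneg_nonneg) auto
    also have "\<dots> = B * norm z ^ n"
      by (simp add: B_def n_def prod.distrib power_add power_mult_distrib)
    finally show ?thesis using hb[of z] by linarith
  qed
  define H where "H = (\<Sum>k\<le>n. monom ((deriv ^^ k) h 0 / fact k) k)"
  have H: "poly H z = h z" for z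
    using Liouville_polynomial[of h 1 B n z, OF hol growth] by (simp add: H_def poly_sum poly_monom)
  have degH: "degree H \<le> n" unfolding H_def
    by (intro degree_sum_le) (auto intro: order_trans[OF degree_monom_le])
  have "L dvd H" unfolding L_def by (rule prod_linear_factors_dvd[OF K]) (simp add: H h_def)
  then obtain G where G: "H = L * G" unfolding dvd_def by blast
  show ?thesis
  proof (rule that[of G])
    show "degree G \<le> r"
    proof (cases "G = 0")
      case False
      then show ?thesis using degH degL Lnz by (simp add: G degree_mult_eq n_def)
    qed simp
    show "poly G z = f z" if "z \<notin> K" for z
      using H[of z] that L0[of z] by (simp add: G h_def)
  qed
qed

section \<open>Transport of blocks along paths\<close>

locale monodromy_blocks =
  fixes P :: "complex poly" and q :: complex and Q :: "complex set set" and r :: nat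
  assumes P: "degree P > 0" and q: "q \<notin> crit_values P"
    and part: "partition_on (fiber P q) Q" and card_Q: "\<And>b. b \<in> Q \<Longrightarrow> card b = r"
    and invar: "\<And>\<sigma> b. \<sigma> \<in> monodromy_group P q \<Longrightarrow> b \<in> Q \<Longrightarrow> \<sigma> ` b \<in> Q"
begin

definition same :: "complex \<Rightarrow> complex \<Rightarrow> bool" where
  "same a b \<longleftrightarrow> (\<exists>c\<in>Q. a \<in> c \<and> b \<in> c)"

text \<open>The block of an arbitrary regular point, obtained by transporting a block of the base fibre
  along a path; invariance of \<open>Q\<close> makes it independent of the path.\<close>
definition block :: "complex \<Rightarrow> complex set" where
  "block z = {w. \<exists>\<gamma> a b. path \<gamma> \<and> path_image \<gamma> \<inter> crit_values P = {} \<and> pathstart \<gamma> = q \<and>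
     same a b \<and> lifts P \<gamma> a z \<and> lifts P \<gamma> b w}"

lemma same_fiber: "same a b \<Longrightarrow> a \<in> fiber P q \<and> b \<in> fiber P q"
  using part by (auto simp: same_def partition_on_def)

lemma same_refl: "a \<in> fiber P q \<Longrightarrow> same a a"
  using part by (auto simp: same_def partition_on_def)

lemma same_sym: "same a b \<Longrightarrow> same b a"
  by (auto simp: same_def)

lemma same_class:
  assumes "c \<in> Q" "a \<in> c"
  shows "same a b \<longleftrightarrow> b \<in> c"
  using assms partition_onD2[OF part] by (auto simp: same_def disjoint_def)

lemma same_trans: "same a b \<Longrightarrow> same b c \<Longrightarrow> same a c"
  using same_class by (metis same_def)

lemma same_monodromy: "\<sigma> \<in> monodromy_group P q \<Longrightarrow> same a b \<Longrightarrow> same (\<sigma> a) (\<sigma> b)"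
  using invar by (meson imageI same_def)

lemma card_same:
  assumes "a \<in> fiber P q"
  shows "card {b. same a b} = r"
proof -
  obtain c where c: "c \<in> Q" "a \<in> c" using assms part by (auto simp: partition_on_def)
  then have "{b. same a b} = c" using same_class by blast
  then show ?thesis using c card_Q by simp
qed

text \<open>A second path to \<open>P z\<close>, followed by \<open>\<gamma>\<close> reversed, is a
  loop; its permutation takes \<open>a'\<close> to \<open>a\<close>, hence the block of
  \<open>a'\<close> to that of \<open>a\<close>.\<close>

lemma block_eq:
  assumes \<gamma>: "path \<gamma>" "path_image \<gamma> \<inter> crit_values P = {}" "pathstart \<gamma> = q" and az: "lifts P \<gamma> a z"
  shows "block z = {w. \<exists>b. same a b \<and> lifts P \<gamma> b w}"
proof (intro equalityI subsetI)
  fix w assume "w \<in> {w. \<exists>b. same a b \<and> lifts P \<gamma> b w}"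
  then show "w \<in> block z" using \<gamma> az unfolding block_def by blast
next
  fix w assume "w \<in> block z"
  then obtain \<gamma>' a' b' where \<gamma>': "path \<gamma>'" "path_image \<gamma>' \<inter> crit_values P = {}" "pathstart \<gamma>' = q"
    and ab: "same a' b'" "lifts P \<gamma>' a' z" "lifts P \<gamma>' b' w" unfolding block_def by blast
  have ends: "pathfinish \<gamma>' = pathfinish \<gamma>"
    using lifts_finish[OF ab(2)] lifts_finish[OF az] by simp
  let ?\<delta> = "\<gamma>' +++ reversepath \<gamma>"
  have \<delta>: "path ?\<delta>" "pathstart ?\<delta> = q" "pathfinish ?\<delta> = q" "path_image ?\<delta> \<inter> crit_values P = {}"
    using \<gamma> \<gamma>' ends by (auto simp: path_image_join)
  obtain \<sigma> where \<sigma>: "\<sigma> \<in> monodromy_group P q" "\<And>z. z \<in> fiber P q \<Longrightarrow> lifts P ?\<delta> z (\<sigma> z)"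
    using loop_induces_monodromy[OF P \<delta>] by metis
  obtain b where b: "lifts P (reversepath \<gamma>) w b"
    by (rule lifts_exists[OF P, of "reversepath \<gamma>" w]) (use \<gamma> ends lifts_finish[OF ab(3)] in auto)
  have F: "a' \<in> fiber P q" "b' \<in> fiber P q" using same_fiber[OF ab(1)] by auto
  have "lifts P ?\<delta> a' a" using ab(2) lifts_reversepath[OF az] by (rule lifts_join)
  then have "\<sigma> a' = a" using lifts_unique[OF P \<delta>(1,4)] \<sigma>(2) F by blast
  moreover have "lifts P ?\<delta> b' b" using ab(3) b by (rule lifts_join)
  then have "\<sigma> b' = b" using lifts_unique[OF P \<delta>(1,4)] \<sigma>(2) F by blast
  ultimately have "same a b" using same_monodromy[OF \<sigma>(1) ab(1)] by simp
  moreover have "lifts P \<gamma> b w" using lifts_reversepath[OF b] by simp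
  ultimately show "w \<in> {w. \<exists>b. same a b \<and> lifts P \<gamma> b w}" by blast
qed

text \<open>The plane minus finitely many points is path connected; a path upstairs from the base
  fibre to \<open>z\<close> projects to the path wanted.\<close>

lemma regular_point_reachable:
  assumes "z \<in> regular_points P"
  obtains \<gamma> a where "path \<gamma>" "path_image \<gamma> \<inter> crit_values P = {}" "pathstart \<gamma> = q"
    "a \<in> fiber P q" "lifts P \<gamma> a z"
proof -
  have "card (fiber P q) > 0" using card_fiber[OF q] P by simp
  then obtain a where a: "a \<in> fiber P q" by (metis card.empty ex_in_conv less_irrefl)
  have "path_connected (- (- regular_points P))"
    using finite_irregular_points[OF P] by (intro path_connected_complement_countable) (auto simp: countable_finite)
  moreover have "a \<in> regular_points P" using a q by (simp add: regular_points_def fiber_def)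
  ultimately obtain p where p: "path p" "path_image p \<subseteq> regular_points P" "pathstart p = a" "pathfinish p = z"
    using assms unfolding double_complement path_connected_def by blast
  show ?thesis
  proof (rule that[of "poly P \<circ> p" a])
    show "path (poly P \<circ> p)" using p(1) by (intro path_continuous_image continuous_intros)
    show "path_image (poly P \<circ> p) \<inter> crit_values P = {}"
      using p(2) by (auto simp: path_image_compose regular_points_def)
    show "pathstart (poly P \<circ> p) = q" using p(3) a by (simp add: pathstart_compose fiber_def)
    show "a \<in> fiber P q" by (rule a)
    show "lifts P (poly P \<circ> p) a z" unfolding lifts_def using p by (intro exI[of _ p]) auto
  qed
qed

text \<open>By \<open>block_eq\<close> one path suffices to describe \<open>block z\<close>, and
  lifting along it is a bijection from the class of \<open>a\<close> onto
  \<open>block z\<close>.\<close>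

lemma
  assumes z: "z \<in> regular_points P"
  shows card_block: "card (block z) = r"
    and mem_block_self: "z \<in> block z"
    and block_subset_fiber: "block z \<subseteq> fiber P (poly P z)"
    and block_cong: "w \<in> block z \<Longrightarrow> block w = block z"
proof -
  obtain \<gamma> a where \<gamma>: "path \<gamma>" "path_image \<gamma> \<inter> crit_values P = {}" "pathstart \<gamma> = q"
    and a: "a \<in> fiber P q" "lifts P \<gamma> a z" using regular_point_reachable[OF z] by metis
  note eq = block_eq[OF \<gamma> a(2)]
  have "\<exists>w. lifts P \<gamma> b w" if "same a b" for b
    using lifts_exists[OF P \<gamma>(1,2), of b] same_fiber[OF that] \<gamma>(3) by (auto simp: fiber_def)
  then obtain t where t: "\<And>b. same a b \<Longrightarrow> lifts P \<gamma> b (t b)" by metis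
  have "block z = t ` {b. same a b}" unfolding eq using t lifts_unique[OF P \<gamma>(1,2)] by blast
  moreover have "inj_on t {b. same a b}"
    using t lifts_inj[OF P \<gamma>(1,2)] by (intro inj_onI) (metis mem_Collect_eq)
  ultimately show "card (block z) = r" using card_same[OF a(1)] by (simp add: card_image)
  show "z \<in> block z" unfolding eq using a same_refl by blast
  show "block z \<subseteq> fiber P (poly P z)"
    unfolding eq fiber_def using lifts_finish[OF a(2)] lifts_finish by auto
  show "block w = block z" if w: "w \<in> block z"
  proof -
    obtain b where b: "same a b" "lifts P \<gamma> b w" using w unfolding eq by blast
    show ?thesis unfolding eq block_eq[OF \<gamma> b(2)] using b(1) same_trans same_sym by blast
  qed
qed

lemma block_transport:
  assumes z: "w \<in> block z" and \<delta>: "path \<delta>" "path_image \<delta> \<inter> crit_values P = {}"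
    and l: "lifts P \<delta> z z'" "lifts P \<delta> w w'"
  shows "w' \<in> block z'"
proof -
  obtain \<gamma> a b where \<gamma>: "path \<gamma>" "path_image \<gamma> \<inter> crit_values P = {}" "pathstart \<gamma> = q"
    and ab: "same a b" "lifts P \<gamma> a z" "lifts P \<gamma> b w" using z unfolding block_def by blast
  have "pathfinish \<gamma> = pathstart \<delta>" using lifts_finish[OF ab(2)] lifts_start[OF l(1)] by simp
  then have "path (\<gamma> +++ \<delta>)" "path_image (\<gamma> +++ \<delta>) \<inter> crit_values P = {}" "pathstart (\<gamma> +++ \<delta>) = q"
    using \<gamma> \<delta> by (auto simp: path_image_join)
  moreover have "lifts P (\<gamma> +++ \<delta>) a z'" "lifts P (\<gamma> +++ \<delta>) b w'"
    using ab l by (auto intro: lifts_join)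
  ultimately show ?thesis using ab(1) unfolding block_def by blast
qed

text \<open>Near \<open>z0\<close> the block of \<open>z\<close> is the image of
  \<open>block z0\<close> under the local sections, so this is a finite product of holomorphic
  functions.\<close>

lemma holomorphic_block_product:
  "(\<lambda>z. \<Prod>w\<in>block z. c - w) holomorphic_on regular_points P"
proof -
  let ?f = "\<lambda>z. \<Prod>w\<in>block z. c - w"
  have "?f field_differentiable (at z0)" if z0: "z0 \<in> regular_points P" for z0
  proof -
    define u where "u = poly P z0"
    have u: "u \<notin> crit_values P" using z0 by (simp add: u_def regular_points_def)
    obtain e W s where e: "e > 0" "ball u e \<inter> crit_values P = {}"
      and W: "\<And>z. z \<in> fiber P u \<Longrightarrow> open (W z) \<and> z \<in> W z \<and> s z holomorphic_on ball u e"
      and sec: "\<And>z x. z \<in> fiber P u \<Longrightarrow> x \<in> ball u e \<Longrightarrow> s z x \<in> W z \<and> poly P (s z x) = x"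
      and ret: "\<And>z w. z \<in> fiber P u \<Longrightarrow> w \<in> W z \<Longrightarrow> poly P w \<in> ball u e \<Longrightarrow> s z (poly P w) = w"
      and disj: "\<And>z z'. z \<in> fiber P u \<Longrightarrow> z' \<in> fiber P u \<Longrightarrow> z \<noteq> z' \<Longrightarrow> W z \<inter> W z' = {}"
      by (rule local_sections[OF P u]) blast
    have z0F: "z0 \<in> fiber P u" by (simp add: u_def fiber_def)
    have bF: "block z0 \<subseteq> fiber P u" using block_subset_fiber[OF z0] by (simp add: u_def)
    define N where "N = W z0 \<inter> poly P -` ball u e"
    have N: "open N" "z0 \<in> N"
      using W[OF z0F] e by (auto simp: N_def u_def intro!: open_Int open_vimage continuous_intros)
    have block: "block z = (\<lambda>w. s w (poly P z)) ` block z0"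
      and inj: "inj_on (\<lambda>w. s w (poly P z)) (block z0)" if z: "z \<in> N" for z
    proof -
      have Pz: "poly P z \<in> ball u e" and zW: "z \<in> W z0" using z by (auto simp: N_def)
      \<comment> \<open>The segment stays in the disc, so the sections lift it, and these lifts
        carry \<open>block z0\<close> into \<open>block z\<close>.\<close>
      let ?\<delta> = "linepath u (poly P z)"
      have im: "path_image ?\<delta> \<subseteq> ball u e"
        using Pz e by (simp add: closed_segment_subset)
      have lift: "lifts P ?\<delta> w (s w (poly P z))" if w: "w \<in> fiber P u" for w
      proof -
        have "s w u = w" using ret[OF w, of w] W[OF w] w e by (simp add: fiber_def)
        moreover have "path (s w \<circ> ?\<delta>)"
          using W[OF w] im by (intro path_continuous_image path_linepath)
             (meson continuous_on_subset holomorphic_on_imp_continuous_on)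
        moreover have "poly P (s w (?\<delta> t)) = ?\<delta> t" if "t \<in> {0..1}" for t
          using sec[OF w, of "?\<delta> t"] im that unfolding path_image_def by blast
        ultimately show ?thesis unfolding lifts_def
          by (intro exI[of _ "s w \<circ> ?\<delta>"]) (auto simp: pathstart_compose pathfinish_compose)
      qed
      have zz: "lifts P ?\<delta> z0 z" using lift[OF z0F] ret[OF z0F zW Pz] by simp
      have "s w (poly P z) \<in> block z" if "w \<in> block z0" for w
        using that lift bF im e(2) by (intro block_transport[OF that _ _ zz]) auto
      then have "(\<lambda>w. s w (poly P z)) ` block z0 \<subseteq> block z" by blast
      moreover show inj: "inj_on (\<lambda>w. s w (poly P z)) (block z0)"
        using sec[OF _ Pz] disj bF by (intro inj_onI) (metis disjoint_iff subsetD)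
      have zV: "z \<in> regular_points P" using Pz e(2) by (auto simp: regular_points_def)
      \<comment> \<open>Both blocks have \<open>r\<close> points, so the inclusion is an
        equality.\<close>
      have "card ((\<lambda>w. s w (poly P z)) ` block z0) = card (block z)"
        using inj card_block[OF z0] card_block[OF zV] by (simp add: card_image)
      moreover have "finite (block z)"
        using block_subset_fiber[OF zV] finite_fiber[OF P] finite_subset by blast
      ultimately show "block z = (\<lambda>w. s w (poly P z)) ` block z0" by (metis card_subset_eq)
    qed
    have "(\<lambda>z. \<Prod>w\<in>block z0. c - s w (poly P z)) holomorphic_on N"
    proof (intro holomorphic_intros)
      fix w assume "w \<in> block z0"
      then have "s w holomorphic_on ball u e" using W bF by blast
      then have "(s w \<circ> poly P) holomorphic_on N"
        by (rule holomorphic_on_compose_gen[rotated]) (auto simp: N_def intro!: holomorphic_intros)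
      then show "(\<lambda>z. s w (poly P z)) holomorphic_on N" by (simp add: o_def)
    qed
    moreover have "(\<Prod>w\<in>block z0. c - s w (poly P z)) = ?f z" if "z \<in> N" for z
      unfolding block[OF that] prod.reindex[OF inj[OF that]] by simp
    ultimately have "?f holomorphic_on N" by (rule holomorphic_transform)
    then show ?thesis using N holomorphic_on_imp_differentiable_at by blast
  qed
  then show ?thesis by (meson field_differentiable_at_within holomorphic_on_def)
qed

text \<open>The inner polynomial is \<open>\<Prod>w\<in>block z. c - w\<close>, as a function of \<open>z\<close>, with \<open>c\<close> in the base
  fibre: the points of \<open>block z\<close> are \<open>O(1 + |z|)\<close>, so its degree is at most \<open>r\<close>; it is constant on
  blocks and vanishes on the block of \<open>c\<close> only, so its degree is exactly \<open>r\<close> and its fibres are the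
  blocks.\<close>
lemma polynomial_decomposition:
  assumes r: "r < degree P"
  obtains R g where "P = R \<circ>\<^sub>p g" "degree g = r"
proof -
  have finV: "finite (- regular_points P)" by (rule finite_irregular_points[OF P])
  have "card (fiber P q) > 0" using card_fiber[OF q] P by simp
  then obtain c where c: "c \<in> fiber P q" by (metis card.empty ex_in_conv less_irrefl)
  have FV: "fiber P q \<subseteq> regular_points P" using q by (auto simp: regular_points_def fiber_def)
  define f where "f z = (\<Prod>w\<in>block z. c - w)" for z
  obtain C where C: "C \<ge> 0" "\<And>z w. poly P w = poly P z \<Longrightarrow> norm w \<le> C * (1 + norm z)"
    by (rule poly_fiber_norm_bound[OF P]) blast
  have finb: "finite (block z)" if "z \<in> regular_points P" for z
    using block_subset_fiber[OF that] finite_fiber[OF P] finite_subset by blast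
  have bound: "norm (f z) \<le> (norm c + C) ^ r * (1 + norm z) ^ r" if z: "z \<in> regular_points P" for z
  proof -
    have "norm (f z) \<le> (\<Prod>w\<in>block z. (norm c + C) * (1 + norm z))"
      unfolding f_def prod_norm[symmetric]
    proof (intro prod_mono conjI)
      fix w assume "w \<in> block z"
      then have "poly P w = poly P z" using block_subset_fiber[OF z] by (auto simp: fiber_def)
      then have "norm w \<le> C * (1 + norm z)" by (rule C(2))
      moreover have "norm c * 1 \<le> norm c * (1 + norm z)" by (intro mult_left_mono) auto
      moreover have "norm (c - w) \<le> norm c + norm w" by (rule norm_triangle_ineq4)
      ultimately show "norm (c - w) \<le> (norm c + C) * (1 + norm z)" unfolding distrib_right by linarith
    qed simp
    then show ?thesis by (simp add: card_block[OF z] power_mult_distrib)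
  qed
  obtain g where g: "degree g \<le> r" "\<And>z. z \<in> regular_points P \<Longrightarrow> poly g z = f z"
  proof (rule holomorphic_polynomial_growth_imp_poly[OF finV, of f "(norm c + C) ^ r" r])
    show "f holomorphic_on - (- regular_points P)"
      unfolding f_def double_complement by (rule holomorphic_block_product)
  qed (use C bound in auto)
  have f0: "f z = 0 \<longleftrightarrow> c \<in> block z" if "z \<in> regular_points P" for z
    using finb[OF that] by (simp add: f_def)
  \<comment> \<open>\<open>r < degree P\<close> leaves a point \<open>a\<close> of the base fibre
    outside the block of \<open>c\<close>; there \<open>g\<close> does not vanish.\<close>
  have "fiber P q - block c \<noteq> {}"
  proof
    assume "fiber P q - block c = {}"
    then have "card (fiber P q) \<le> card (block c)" using finb FV c by (intro card_mono) auto
    then show False using card_fiber[OF q] card_block FV c r by auto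
  qed
  then obtain a where a: "a \<in> fiber P q" "a \<notin> block c" by blast
  have "c \<notin> block a" using block_cong[of a c] mem_block_self[of a] a FV by auto
  then have "poly g a \<noteq> 0" using g(2) f0 a FV by auto
  then have g0: "g \<noteq> 0" by auto
  have const: "poly g w = poly g z" if "z \<in> regular_points P" "w \<in> block z" for z w
  proof -
    have "w \<in> regular_points P"
      using that block_subset_fiber[OF that(1)] by (auto simp: regular_points_def fiber_def)
    then show ?thesis using g(2) that block_cong[OF that] by (simp add: f_def)
  qed
  have cV: "c \<in> regular_points P" using c FV by blast
  have gc: "poly g c = 0" using g(2)[OF cV] f0[OF cV] mem_block_self[OF cV] by simp
  \<comment> \<open>\<open>g\<close> vanishes at all \<open>r\<close> points of
    \<open>block c\<close>.\<close>
  have "r \<le> card {w. poly g w = 0}"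
    unfolding card_block[OF cV, symmetric]
    by (rule card_mono[OF poly_roots_finite[OF g0]]) (use const[OF cV] gc in auto)
  then have degg: "degree g = r" using card_poly_roots_bound[OF g0] g(1) by simp
  have "degree g > 0"
  proof (rule ccontr)
    assume "\<not> 0 < degree g"
    then obtain k where "g = [:k:]" by (auto elim: degree_eq_zeroE)
    then show False using gc \<open>poly g a \<noteq> 0\<close> by simp
  qed
  \<comment> \<open>\<open>g\<close> is constant on the \<open>r\<close> points of a block and takes
    no value more than \<open>r\<close> times.\<close>
  have blk: "{w. poly g w = poly g z} = block z" if z: "z \<in> regular_points P" for z
  proof -
    have nz: "g - [:poly g z:] \<noteq> 0" by (rule diff_const_nonzero[OF \<open>degree g > 0\<close>])
    have "card {w. poly g w = poly g z} \<le> r"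
      using card_poly_roots_bound[OF nz] by (simp add: degree_diff_const degg)
    moreover have "finite {w. poly g w = poly g z}" using poly_roots_finite[OF nz] by simp
    ultimately show ?thesis using const[OF z] card_block[OF z]
      by (intro card_seteq[symmetric]) auto
  qed
  have "\<exists>R. P = R \<circ>\<^sub>p g"
  proof (rule poly_decomposition_if_const_on_fibers[OF \<open>degree g > 0\<close>, of "regular_points P"])
    show "infinite (regular_points P)"
      using finV by (metis Compl_eq_Diff_UNIV Diff_infinite_finite double_complement infinite_UNIV_char_0)
    show "card {w. poly g w = poly g z} = degree g" if "z \<in> regular_points P" for z
      using that by (simp add: blk card_block degg)
    show "poly P w = poly P z" if "z \<in> regular_points P" "poly g w = poly g z" for z w
      using blk[OF that(1)] that(2) block_subset_fiber[OF that(1)] by (auto simp: fiber_def)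
  qed
  then show ?thesis using that degg by blast
qed

end

section \<open>Powers of solutions and imprimitivity of the monodromy group\<close>

theorem theorem6p2:
  fixes d n m :: nat and D A B :: "complex poly" and q :: complex
  assumes "d \<ge> 2"
    and "squarefree D" and "degree D = 2 * d"
    and "pell_solution D A B" and "degree A = n"
    and "q \<notin> crit_values (A^2)"
    and "m > 0" and "m dvd n" and "n div m \<ge> d"
  shows "(\<exists>A' B'. pell_solution D A' B' \<and> is_pell_power D A B m A' B') \<longleftrightarrow>
         imprimitive (2 * m) (monodromy_group (A^2) q) (fiber (A^2) q)"
proof
  \<comment> \<open>\<open>n div m \<ge> d \<ge> 2\<close> excludes \<open>n = 0\<close>.\<close>
  have n: "n > 0" using assms(1,7,9) by (cases n) auto
  have degA2: "degree (A\<^sup>2) = 2 * n" using assms(5) n by (subst degree_power_eq) auto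
  {
    assume "\<exists>A' B'. pell_solution D A' B' \<and> is_pell_power D A B m A' B'"
    then obtain A' B' where "pell_solution D A' B'" "is_pell_power D A B m A' B'" by blast
    then have dec: "A\<^sup>2 = ((fst (cheb m))\<^sup>2) \<circ>\<^sub>p A'" by (rule is_pell_power_imp_cheb)
    have degR: "degree ((fst (cheb m))\<^sup>2) = 2 * m"
      using assms(7) degree_cheb[of m] by (subst degree_power_eq) auto
    \<comment> \<open>A constant \<open>A'\<close> would make \<open>A^2\<close> constant.\<close>
    have "degree A' > 0" using degA2 n unfolding dec degree_pcompose by (cases "degree A' = 0") simp_all
    then show "imprimitive (2 * m) (monodromy_group (A\<^sup>2) q) (fiber (A\<^sup>2) q)"
      using imprimitive_if_decomposition[of "(fst (cheb m))\<^sup>2" A' q] assms(6,7) degR dec by simp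
  }
  assume "imprimitive (2 * m) (monodromy_group (A\<^sup>2) q) (fiber (A\<^sup>2) q)"
  then obtain Q where Q: "partition_on (fiber (A\<^sup>2) q) Q"
      "\<And>b. b \<in> Q \<Longrightarrow> card b = card (fiber (A\<^sup>2) q) div (2 * m)"
      "\<And>\<sigma> b. \<sigma> \<in> monodromy_group (A\<^sup>2) q \<Longrightarrow> b \<in> Q \<Longrightarrow> \<sigma> ` b \<in> Q"
    unfolding imprimitive_def by blast
  define r where "r = n div m"
  \<comment> \<open>The fibre has \<open>2 * n\<close> points, so a block has
    \<open>n / m\<close>.\<close>
  have r: "card (fiber (A\<^sup>2) q) div (2 * m) = r" "n = m * r"
    using card_fiber[OF assms(6)] degA2 assms(8) by (simp_all add: r_def)
  interpret monodromy_blocks "A\<^sup>2" q Q r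
    by unfold_locales (use degA2 n assms(6) Q r in auto)
  \<comment> \<open>\<open>r \<le> n < 2 * n\<close>: a block is never the whole fibre, as
    \<open>polynomial_decomposition\<close> demands.\<close>
  have "r \<le> n" by (simp add: r_def)
  then have "r < degree (A\<^sup>2)" using degA2 n by linarith
  then obtain R g where dec: "A\<^sup>2 = R \<circ>\<^sub>p g" and g: "degree g = r" by (rule polynomial_decomposition)
  have "degree R * r = 2 * m * r" using degA2 r(2) unfolding dec degree_pcompose g by auto
  moreover have "r > 0" using r(2) n by (cases r) auto
  ultimately have "degree R = 2 * m" by simp
  then show "\<exists>A' B'. pell_solution D A' B' \<and> is_pell_power D A B m A' B'"
    using pell_power_of_decomposition[OF assms(2,3,4) dec _ assms(7)] g \<open>r > 0\<close> assms(9) r_def by simp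
qed

end
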